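(* Let $K$ be a field. For any finite undirected graphs $\Gamma_1$ and $\Gamma_2$ without loops and multiple edges, the graph Lie algebras $L(\Gamma_1)$ and $L(\Gamma_2)$ over $K$ satisfy $$L(\Gamma_1)\cong L(\Gamma_2)\ \text{(as Lie algebras over } K)\quad\Longleftrightarrow\quad \Gamma_1\cong\Gamma_2\ \text{(as graphs)}.$$
   Context: Let $\Gamma=(T,E)$ be a finite undirected graph without loops and multiple edges, with vertex set $T=\{v_1,\dots,v_n\}$ and edge set $E$. Let $V$ be the $K$-vector space with basis $v_1,\dots,v_n$, and let $\wedge^2V=V\otimes V/\operatorname{Span}_K\{v\otimes v\mid v\in V\}$ be its exterior square. The free 2-step nilpotent Lie algebra of rank $n$ over $K$ is realized as $N_n=V\oplus\wedge^2V$ with bracket determined by $[v_i,v_j]=v_i\wedge v_j$ and $[v_i,v_j\wedge v_k]=[v_i\wedge v_j,v_k]=[v_i\wedge v_k,v_j\wedge v_l]=0$ for all $i,j,k,l$. Put $I=\operatorname{Span}_K\{v_i\wedge v_j\mid \{v_i,v_j\}\in E\}\subseteq\wedge^2V$, which is an ideal of $N_n$. The graph Lie algebra corresponding to $\Gamma$ is $L(\Gamma)=N_n/I$. *)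

theory Defs
  imports "Graph_Theory.Graph_Theory" "Jordan_Normal_Form.VS_Connect" "HOL-Algebra.QuotRing"
begin

text \<open>
  A Lie algebra is a module record whose \<open>mult\<close> component is the Lie bracket. The component \<open>one\<close>
  of the record has no meaning here.
\<close>

locale lie_algebra = vectorspace K L for K :: "('k, 'm) ring_scheme" (structure)
    and L :: "('k, 'v, 'n) module_scheme" (structure) +
  assumes bracket_closed: "\<lbrakk>x \<in> carrier L; y \<in> carrier L\<rbrakk> \<Longrightarrow> x \<otimes>\<^bsub>L\<^esub> y \<in> carrier L"
    and bracket_add_left: "\<lbrakk>x \<in> carrier L; y \<in> carrier L; z \<in> carrier L\<rbrakk> \<Longrightarrow>
      (x \<oplus>\<^bsub>L\<^esub> y) \<otimes>\<^bsub>L\<^esub> z = x \<otimes>\<^bsub>L\<^esub> z \<oplus>\<^bsub>L\<^esub> y \<otimes>\<^bsub>L\<^esub> z"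
    and bracket_add_right: "\<lbrakk>x \<in> carrier L; y \<in> carrier L; z \<in> carrier L\<rbrakk> \<Longrightarrow>
      x \<otimes>\<^bsub>L\<^esub> (y \<oplus>\<^bsub>L\<^esub> z) = x \<otimes>\<^bsub>L\<^esub> y \<oplus>\<^bsub>L\<^esub> x \<otimes>\<^bsub>L\<^esub> z"
    and bracket_smult_left: "\<lbrakk>c \<in> carrier K; x \<in> carrier L; y \<in> carrier L\<rbrakk> \<Longrightarrow>
      (c \<odot>\<^bsub>L\<^esub> x) \<otimes>\<^bsub>L\<^esub> y = c \<odot>\<^bsub>L\<^esub> (x \<otimes>\<^bsub>L\<^esub> y)"
    and bracket_smult_right: "\<lbrakk>c \<in> carrier K; x \<in> carrier L; y \<in> carrier L\<rbrakk> \<Longrightarrow>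
      x \<otimes>\<^bsub>L\<^esub> (c \<odot>\<^bsub>L\<^esub> y) = c \<odot>\<^bsub>L\<^esub> (x \<otimes>\<^bsub>L\<^esub> y)"
    and bracket_self: "x \<in> carrier L \<Longrightarrow> x \<otimes>\<^bsub>L\<^esub> x = \<zero>\<^bsub>L\<^esub>"
    and jacobi: "\<lbrakk>x \<in> carrier L; y \<in> carrier L; z \<in> carrier L\<rbrakk> \<Longrightarrow>
      x \<otimes>\<^bsub>L\<^esub> (y \<otimes>\<^bsub>L\<^esub> z) \<oplus>\<^bsub>L\<^esub> (y \<otimes>\<^bsub>L\<^esub> (z \<otimes>\<^bsub>L\<^esub> x) \<oplus>\<^bsub>L\<^esub> z \<otimes>\<^bsub>L\<^esub> (x \<otimes>\<^bsub>L\<^esub> y)) = \<zero>\<^bsub>L\<^esub>"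

locale lie_ideal = lie_algebra K L + submodule K I L for K (structure) and L (structure) and I +
  assumes bracket_in_ideal: "\<lbrakk>x \<in> carrier L; a \<in> I\<rbrakk> \<Longrightarrow> x \<otimes>\<^bsub>L\<^esub> a \<in> I"

definition lie_isomorphic ::
    "('k, 'm) ring_scheme \<Rightarrow> ('k, 'v, 'n) module_scheme \<Rightarrow> ('k, 'w, 'p) module_scheme \<Rightarrow> bool" where
  "lie_isomorphic K L M \<longleftrightarrow> (\<exists>f \<in> module_hom K L M. bij_betw f (carrier L) (carrier M) \<and>
     (\<forall>x \<in> carrier L. \<forall>y \<in> carrier L. f (x \<otimes>\<^bsub>L\<^esub> y) = f x \<otimes>\<^bsub>M\<^esub> f y))"

text \<open>
  The quotient of \<open>M\<close> by \<open>N\<close>: \<^const>\<open>FactRing\<close> with the induced scalar multiplication. It serves for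
  quotients of vector spaces, where \<open>mult\<close> is ignored, and for quotients of Lie algebras by ideals,
  where \<open>mult\<close> is the induced bracket.
\<close>

definition quotient_module ::
    "('k, 'v, 'n) module_scheme \<Rightarrow> 'v set \<Rightarrow> ('k, 'v set) module" where
  "quotient_module M N = \<lparr>carrier = a_rcosets\<^bsub>M\<^esub> N, mult = rcoset_mult M N, one = N +>\<^bsub>M\<^esub> \<one>\<^bsub>M\<^esub>,
     zero = N, add = set_add M, smult = (\<lambda>c X. \<Union>x \<in> X. N +>\<^bsub>M\<^esub> (c \<odot>\<^bsub>M\<^esub> x))\<rparr>"

lemma (in module) abelian_subgroup_submodule:
  assumes "submodule R N M"
  shows "abelian_subgroup N M"
proof (rule abelian_subgroupI3)
  interpret N: submodule R N M by fact
  show "additive_subgroup N M"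
  proof (rule additive_subgroupI, rule group.subgroupI)
    show "group (add_monoid M)" by (rule M.a_group)
    show "N \<subseteq> carrier (add_monoid M)" using N.subset by simp
    show "N \<noteq> {}" using N.zero_closed by blast
    fix a assume a: "a \<in> N"
    have "\<ominus>\<^bsub>M\<^esub> a = (\<ominus>\<^bsub>R\<^esub> \<one>\<^bsub>R\<^esub>) \<odot>\<^bsub>M\<^esub> a"
      using a N.subset by (simp add: smult_l_minus subset_iff)
    also have "\<dots> \<in> N" using a by auto
    finally show "inv\<^bsub>add_monoid M\<^esub> a \<in> N" by (simp add: a_inv_def)
  qed auto
qed (rule M.abelian_group_axioms)

lemma (in module) quotient_smult:
  assumes N: "submodule R N M" and c: "c \<in> carrier R" and x: "x \<in> carrier M"
  shows "c \<odot>\<^bsub>quotient_module M N\<^esub> (N +>\<^bsub>M\<^esub> x) = N +>\<^bsub>M\<^esub> (c \<odot>\<^bsub>M\<^esub> x)"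
proof -
  interpret N: submodule R N M by fact
  interpret A: abelian_subgroup N M by (rule abelian_subgroup_submodule[OF N])
  have eq: "N +>\<^bsub>M\<^esub> (c \<odot>\<^bsub>M\<^esub> z) = N +>\<^bsub>M\<^esub> (c \<odot>\<^bsub>M\<^esub> x)" if z: "z \<in> N +>\<^bsub>M\<^esub> x" for z
  proof -
    obtain h where h: "h \<in> N" "z = h \<oplus>\<^bsub>M\<^esub> x" using z by (auto simp: a_r_coset_def')
    have hM: "h \<in> carrier M" using h N.subset by auto
    have "c \<odot>\<^bsub>M\<^esub> z = c \<odot>\<^bsub>M\<^esub> h \<oplus>\<^bsub>M\<^esub> c \<odot>\<^bsub>M\<^esub> x" using h hM c x by (simp add: smult_r_distr)
    moreover have "c \<odot>\<^bsub>M\<^esub> h \<in> N" using c h by simp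
    ultimately have "c \<odot>\<^bsub>M\<^esub> z \<in> N +>\<^bsub>M\<^esub> (c \<odot>\<^bsub>M\<^esub> x)" by (auto simp: a_r_coset_def')
    then show ?thesis using A.a_repr_independence' c x by (metis smult_closed)
  qed
  have "x \<in> N +>\<^bsub>M\<^esub> x" using x A.a_rcos_self by simp
  then have "(\<Union>z \<in> N +>\<^bsub>M\<^esub> x. N +>\<^bsub>M\<^esub> (c \<odot>\<^bsub>M\<^esub> z)) = N +>\<^bsub>M\<^esub> (c \<odot>\<^bsub>M\<^esub> x)"
    by (intro SUP_eq_const eq) blast+
  then show ?thesis by (simp add: quotient_module_def)
qed

lemma (in module) quotient_add:
  assumes N: "submodule R N M" and "x \<in> carrier M" and "y \<in> carrier M"
  shows "(N +>\<^bsub>M\<^esub> x) \<oplus>\<^bsub>quotient_module M N\<^esub> (N +>\<^bsub>M\<^esub> y) = N +>\<^bsub>M\<^esub> (x \<oplus>\<^bsub>M\<^esub> y)"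
  using abelian_subgroup.a_rcos_sum[OF abelian_subgroup_submodule[OF N]] assms(2-)
  by (simp add: quotient_module_def)

lemma (in module) quotient_zero:
  assumes N: "submodule R N M"
  shows "\<zero>\<^bsub>quotient_module M N\<^esub> = N +>\<^bsub>M\<^esub> \<zero>\<^bsub>M\<^esub>"
  using submodule.subset[OF N] by (simp add: quotient_module_def)

lemma carrier_quotient:
  "carrier (quotient_module M N) = (\<lambda>x. N +>\<^bsub>M\<^esub> x) ` carrier M"
  by (auto simp: quotient_module_def A_RCOSETS_def')

lemma (in module) module_quotient:
  assumes N: "submodule R N M"
  shows "module R (quotient_module M N)"
proof -
  note q = quotient_add[OF N] quotient_smult[OF N] quotient_zero[OF N] carrier_quotient
  show ?thesis
  proof (rule module_criteria)
    show "\<forall>v\<in>carrier (quotient_module M N). \<exists>w\<in>carrier (quotient_module M N).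
        v \<oplus>\<^bsub>quotient_module M N\<^esub> w = \<zero>\<^bsub>quotient_module M N\<^esub>"
    proof
      fix v assume "v \<in> carrier (quotient_module M N)"
      then obtain x where "x \<in> carrier M" "v = N +>\<^bsub>M\<^esub> x" by (auto simp: q)
      then show "\<exists>w\<in>carrier (quotient_module M N).
          v \<oplus>\<^bsub>quotient_module M N\<^esub> w = \<zero>\<^bsub>quotient_module M N\<^esub>"
        by (intro bexI[of _ "N +>\<^bsub>M\<^esub> (\<ominus>\<^bsub>M\<^esub> x)"]) (auto simp: q M.r_neg)
    qed
  qed (auto simp: q R.is_cring smult_l_distr smult_r_distr smult_assoc1 M.a_ac)
qed

lemma (in lie_ideal) quotient_bracket:
  assumes x: "x \<in> carrier L" and y: "y \<in> carrier L"
  shows "(I +>\<^bsub>L\<^esub> x) \<otimes>\<^bsub>quotient_module L I\<^esub> (I +>\<^bsub>L\<^esub> y) = I +>\<^bsub>L\<^esub> (x \<otimes>\<^bsub>L\<^esub> y)"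
proof -
  have sub: "submodule K I L" by unfold_locales
  interpret A: abelian_subgroup I L by (rule abelian_subgroup_submodule[OF sub])
  have left: "b \<otimes>\<^bsub>L\<^esub> z \<in> I" if b: "b \<in> I" and z: "z \<in> carrier L" for b z
  proof -
    have bL: "b \<in> carrier L" using b subset by auto
    have "\<zero>\<^bsub>L\<^esub> = (z \<oplus>\<^bsub>L\<^esub> b) \<otimes>\<^bsub>L\<^esub> (z \<oplus>\<^bsub>L\<^esub> b)"
      using bL z by (simp add: bracket_self)
    also have "\<dots> = z \<otimes>\<^bsub>L\<^esub> b \<oplus>\<^bsub>L\<^esub> b \<otimes>\<^bsub>L\<^esub> z"
      using bL z
      by (simp add: bracket_add_left bracket_add_right bracket_self[OF bL] bracket_self[OF z]
          bracket_closed M.a_comm)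
    finally have "b \<otimes>\<^bsub>L\<^esub> z = \<ominus>\<^bsub>L\<^esub> (z \<otimes>\<^bsub>L\<^esub> b)"
      using bL z by (metis M.minus_equality M.minus_minus M.a_comm bracket_closed)
    then show ?thesis using bracket_in_ideal[OF z b] by (simp add: A.a_inv_closed)
  qed
  have eq: "I +>\<^bsub>L\<^esub> (u \<otimes>\<^bsub>L\<^esub> w) = I +>\<^bsub>L\<^esub> (x \<otimes>\<^bsub>L\<^esub> y)"
    if u: "u \<in> I +>\<^bsub>L\<^esub> x" and w: "w \<in> I +>\<^bsub>L\<^esub> y" for u w
  proof -
    obtain a b where a: "a \<in> I" "u = a \<oplus>\<^bsub>L\<^esub> x" and b: "b \<in> I" "w = b \<oplus>\<^bsub>L\<^esub> y"
      using u w by (auto simp: a_r_coset_def')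
    have aL: "a \<in> carrier L" and bL: "b \<in> carrier L" using a b subset by auto
    have "u \<otimes>\<^bsub>L\<^esub> w = (a \<otimes>\<^bsub>L\<^esub> w \<oplus>\<^bsub>L\<^esub> x \<otimes>\<^bsub>L\<^esub> b) \<oplus>\<^bsub>L\<^esub> x \<otimes>\<^bsub>L\<^esub> y"
      using a b aL bL x y
      by (simp add: bracket_add_left bracket_add_right bracket_closed M.a_ac)
    moreover have "a \<otimes>\<^bsub>L\<^esub> w \<oplus>\<^bsub>L\<^esub> x \<otimes>\<^bsub>L\<^esub> b \<in> I"
      using left[OF a(1), of w] bracket_in_ideal[OF x b(1)] b bL y by simp
    ultimately have "u \<otimes>\<^bsub>L\<^esub> w \<in> I +>\<^bsub>L\<^esub> (x \<otimes>\<^bsub>L\<^esub> y)" by (auto simp: a_r_coset_def')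
    then show ?thesis using A.a_repr_independence' x y by (metis bracket_closed)
  qed
  have ne: "x \<in> I +>\<^bsub>L\<^esub> x" "y \<in> I +>\<^bsub>L\<^esub> y" using x y A.a_rcos_self by simp_all
  have "(\<Union>u \<in> I +>\<^bsub>L\<^esub> x. \<Union>w \<in> I +>\<^bsub>L\<^esub> y. I +>\<^bsub>L\<^esub> (u \<otimes>\<^bsub>L\<^esub> w)) = I +>\<^bsub>L\<^esub> (x \<otimes>\<^bsub>L\<^esub> y)"
    using ne by (intro SUP_eq_const eq) blast+
  then show ?thesis by (simp add: quotient_module_def rcoset_mult_def)
qed

theorem (in lie_ideal) lie_algebra_quotient: "lie_algebra K (quotient_module L I)"
proof -
  have sub: "submodule K I L" by unfold_locales
  note q = quotient_add[OF sub] quotient_smult[OF sub] quotient_zero[OF sub] carrier_quotient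
    quotient_bracket
  interpret Q: module K "quotient_module L I" by (rule module_quotient[OF sub])
  show ?thesis
    by unfold_locales
      (auto simp: q bracket_closed bracket_add_left bracket_add_right bracket_smult_left
        bracket_smult_right bracket_self jacobi)
qed


text \<open>
  The vector space with basis \<open>T\<close> consists of the functions on the finite set \<open>T\<close>; its tensor square
  has basis \<open>T \<times> T\<close>, the pair \<open>(i, j)\<close> standing for the tensor product of the basis vectors \<open>i\<close>, \<open>j\<close>.
\<close>

abbreviation vertex_space :: "'a set \<Rightarrow> ('k::field, 'a \<Rightarrow> 'k) module" where
  "vertex_space T \<equiv> ring.func_space class_ring T"

definition vertex_vector :: "'a set \<Rightarrow> 'a \<Rightarrow> 'a \<Rightarrow> 'k::field" where
  "vertex_vector T i = (\<lambda>j \<in> T. if j = i then 1 else 0)"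

abbreviation tensor_square :: "'a set \<Rightarrow> ('k::field, 'a \<times> 'a \<Rightarrow> 'k) module" where
  "tensor_square T \<equiv> ring.func_space class_ring (T \<times> T)"

definition tensor :: "'a set \<Rightarrow> ('a \<Rightarrow> 'k) \<Rightarrow> ('a \<Rightarrow> 'k) \<Rightarrow> 'a \<times> 'a \<Rightarrow> 'k::field" where
  "tensor T v w = (\<lambda>(i, j) \<in> T \<times> T. v i * w j)"

definition square_tensors :: "'a set \<Rightarrow> ('a \<times> 'a \<Rightarrow> 'k::field) set" where
  "square_tensors T =
     module.span class_ring (tensor_square T) {tensor T v v | v. v \<in> carrier (vertex_space T)}"

definition exterior_square :: "'a set \<Rightarrow> ('k::field, ('a \<times> 'a \<Rightarrow> 'k) set) module" where
  "exterior_square T = quotient_module (tensor_square T) (square_tensors T)"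

definition wedge :: "'a set \<Rightarrow> ('a \<Rightarrow> 'k) \<Rightarrow> ('a \<Rightarrow> 'k) \<Rightarrow> ('a \<times> 'a \<Rightarrow> 'k::field) set" where
  "wedge T v w = square_tensors T +>\<^bsub>tensor_square T\<^esub> tensor T v w"

text \<open>
  The bracket is the bilinear extension of \<open>[i, j] = i \<and> j\<close>, all brackets with an
  element of the exterior square being zero.
\<close>

definition free_nilpotent_lie_algebra ::
    "'a set \<Rightarrow> ('k::field, ('a \<Rightarrow> 'k) \<times> ('a \<times> 'a \<Rightarrow> 'k) set) module" where
  "free_nilpotent_lie_algebra T = (direct_sum (vertex_space T) (exterior_square T))
     \<lparr>mult := (\<lambda>(v, a) (w, b). (\<zero>\<^bsub>vertex_space T\<^esub>, wedge T v w))\<rparr>"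

definition edge_ideal ::
    "('a, 'b) pre_digraph \<Rightarrow> (('a \<Rightarrow> 'k::field) \<times> ('a \<times> 'a \<Rightarrow> 'k) set) set" where
  "edge_ideal G = inj2 (vertex_space (verts G)) (exterior_square (verts G)) `
     module.span class_ring (exterior_square (verts G))
       {wedge (verts G) (vertex_vector (verts G) i) (vertex_vector (verts G) j) | i j. i \<rightarrow>\<^bsub>G\<^esub> j}"

definition graph_lie_algebra ::
    "('a, 'b) pre_digraph \<Rightarrow> ('k::field, (('a \<Rightarrow> 'k) \<times> ('a \<times> 'a \<Rightarrow> 'k) set) set) module" where
  "graph_lie_algebra G = quotient_module (free_nilpotent_lie_algebra (verts G)) (edge_ideal G)"

lemma module_func_space: "module (class_ring :: 'k::field ring) (ring.func_space class_ring S)"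
  by (rule cring.func_space_is_module[OF class_cring.is_cring])

lemma func_space_simps:
  "carrier (ring.func_space (class_ring :: 'k::field ring) S) = (S \<rightarrow>\<^sub>E UNIV)"
  "zero (ring.func_space (class_ring :: 'k ring) S) = (\<lambda>_ \<in> S. 0)"
  "add (ring.func_space (class_ring :: 'k ring) S) = (\<lambda>v w. \<lambda>i \<in> S. v i + w i)"
  "smult (ring.func_space (class_ring :: 'k ring) S) = (\<lambda>c v. \<lambda>i \<in> S. c * v i)"
  by (simp_all add: ring.func_space_def[OF class_ring.ring_axioms])

lemma vertex_vector_in_carrier: "vertex_vector T i \<in> carrier (vertex_space T)"
  by (simp add: vertex_vector_def func_space_simps)

lemma tensor_in_carrier: "tensor T v w \<in> carrier (tensor_square T)"
  by (simp add: tensor_def func_space_simps)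

lemma tensor_bilinear:
  "tensor T (v \<oplus>\<^bsub>vertex_space T\<^esub> v') w = tensor T v w \<oplus>\<^bsub>tensor_square T\<^esub> tensor T v' w"
  "tensor T v (w \<oplus>\<^bsub>vertex_space T\<^esub> w') = tensor T v w \<oplus>\<^bsub>tensor_square T\<^esub> tensor T v w'"
  "tensor T (c \<odot>\<^bsub>vertex_space T\<^esub> v) w = c \<odot>\<^bsub>tensor_square T\<^esub> tensor T v w"
  "tensor T v (c \<odot>\<^bsub>vertex_space T\<^esub> w) = c \<odot>\<^bsub>tensor_square T\<^esub> tensor T v w"
  by (auto simp: tensor_def func_space_simps fun_eq_iff algebra_simps)

lemma submodule_square_tensors:
  "submodule (class_ring :: 'k::field ring) (square_tensors T) (tensor_square T)"
  unfolding square_tensors_def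
  by (rule module.span_is_submodule[OF module_func_space]) (auto simp: tensor_in_carrier)

lemma module_exterior_square: "module (class_ring :: 'k::field ring) (exterior_square T)"
  unfolding exterior_square_def
  by (rule module.module_quotient[OF module_func_space submodule_square_tensors])

lemma wedge_in_carrier: "wedge T v w \<in> carrier (exterior_square T)"
  by (auto simp: wedge_def exterior_square_def carrier_quotient tensor_in_carrier)

lemma wedge_bilinear:
  "wedge T (v \<oplus>\<^bsub>vertex_space T\<^esub> v') w = wedge T v w \<oplus>\<^bsub>exterior_square T\<^esub> wedge T v' w"
  "wedge T v (w \<oplus>\<^bsub>vertex_space T\<^esub> w') = wedge T v w \<oplus>\<^bsub>exterior_square T\<^esub> wedge T v w'"
  "wedge T (c \<odot>\<^bsub>vertex_space T\<^esub> v) w = c \<odot>\<^bsub>exterior_square T\<^esub> wedge T v w"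
  "wedge T v (c \<odot>\<^bsub>vertex_space T\<^esub> w) = c \<odot>\<^bsub>exterior_square T\<^esub> wedge T v w"
  by (simp_all add: wedge_def exterior_square_def tensor_bilinear tensor_in_carrier
      module.quotient_add[OF module_func_space submodule_square_tensors]
      module.quotient_smult[OF module_func_space submodule_square_tensors])

lemma wedge_self:
  assumes "v \<in> carrier (vertex_space T)"
  shows "wedge T v v = \<zero>\<^bsub>exterior_square T\<^esub>"
proof -
  interpret A: abelian_subgroup "square_tensors T" "tensor_square T"
    by (rule module.abelian_subgroup_submodule[OF module_func_space submodule_square_tensors])
  have "tensor T v v \<in> square_tensors T"
    unfolding square_tensors_def
    using module.in_own_span[OF module_func_space, of "{tensor T v v |v. v \<in> carrier (vertex_space T)}"]
      assms tensor_in_carrier by blast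
  then show ?thesis
    by (simp add: wedge_def exterior_square_def quotient_module_def A.a_rcos_const)
qed

lemma wedge_zero:
  "wedge T \<zero>\<^bsub>vertex_space T\<^esub> w = \<zero>\<^bsub>exterior_square T\<^esub>"
  "wedge T v \<zero>\<^bsub>vertex_space T\<^esub> = \<zero>\<^bsub>exterior_square T\<^esub>"
proof -
  have "tensor T \<zero>\<^bsub>vertex_space T\<^esub> w = \<zero>\<^bsub>tensor_square T\<^esub>"
    "tensor T v \<zero>\<^bsub>vertex_space T\<^esub> = \<zero>\<^bsub>tensor_square T\<^esub>"
    by (auto simp: tensor_def func_space_simps fun_eq_iff)
  then show "wedge T \<zero>\<^bsub>vertex_space T\<^esub> w = \<zero>\<^bsub>exterior_square T\<^esub>"
    "wedge T v \<zero>\<^bsub>vertex_space T\<^esub> = \<zero>\<^bsub>exterior_square T\<^esub>"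
    by (simp_all add: wedge_def exterior_square_def
        module.quotient_zero[OF module_func_space submodule_square_tensors])
qed

lemma free_nilpotent_simps:
  "carrier (free_nilpotent_lie_algebra T) = carrier (vertex_space T) \<times> carrier (exterior_square T)"
  "zero (free_nilpotent_lie_algebra T) = (\<zero>\<^bsub>vertex_space T\<^esub>, \<zero>\<^bsub>exterior_square T\<^esub>)"
  "(v, a) \<oplus>\<^bsub>free_nilpotent_lie_algebra T\<^esub> (w, b) =
    (v \<oplus>\<^bsub>vertex_space T\<^esub> w, a \<oplus>\<^bsub>exterior_square T\<^esub> b)"
  "c \<odot>\<^bsub>free_nilpotent_lie_algebra T\<^esub> (v, a) =
    (c \<odot>\<^bsub>vertex_space T\<^esub> v, c \<odot>\<^bsub>exterior_square T\<^esub> a)"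
  "(v, a) \<otimes>\<^bsub>free_nilpotent_lie_algebra T\<^esub> (w, b) = (\<zero>\<^bsub>vertex_space T\<^esub>, wedge T v w)"
  by (simp_all add: free_nilpotent_lie_algebra_def direct_sum_def)

theorem lie_algebra_free_nilpotent:
  "lie_algebra (class_ring :: 'k::field ring) (free_nilpotent_lie_algebra T)"
proof -
  let ?N = "free_nilpotent_lie_algebra T :: ('k, _) module"
  let ?S = "direct_sum (vertex_space T) (exterior_square T) :: ('k, _) module"
  interpret V: module "class_ring :: 'k ring" "vertex_space T" by (rule module_func_space)
  interpret W: module "class_ring :: 'k ring" "exterior_square T" by (rule module_exterior_square)
  interpret S: module "class_ring :: 'k ring" ?S
    by (rule direct_sum_is_module[OF module_func_space module_exterior_square])
  have N: "carrier ?N = carrier ?S" "zero ?N = zero ?S" "add ?N = add ?S" "smult ?N = smult ?S"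
    by (simp_all add: free_nilpotent_lie_algebra_def)
  have "module class_ring ?N"
  proof (rule module_criteria)
    show "\<forall>v\<in>carrier ?N. \<exists>w\<in>carrier ?N. v \<oplus>\<^bsub>?N\<^esub> w = \<zero>\<^bsub>?N\<^esub>"
      unfolding N using S.M.r_neg S.M.a_inv_closed by blast
  qed (simp_all add: N S.smult_l_distr[simplified] S.smult_r_distr[simplified]
      S.smult_assoc1[simplified] S.smult_one[simplified] S.smult_closed[simplified] S.M.a_ac
      class_cring.is_cring)
  then interpret N: vectorspace "class_ring :: 'k ring" ?N
    by (intro vectorspace.intro class_field)
  show ?thesis
  proof unfold_locales
  qed (auto simp: free_nilpotent_simps wedge_in_carrier wedge_bilinear wedge_self wedge_zero)
qed

theorem lie_ideal_edge_ideal: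
  fixes G :: "('a, 'b) pre_digraph"
  shows "lie_ideal (class_ring :: 'k::field ring) (free_nilpotent_lie_algebra (verts G)) (edge_ideal G)"
proof -
  let ?T = "verts G"
  let ?E = "{wedge ?T (vertex_vector ?T i) (vertex_vector ?T j) | i j. i \<rightarrow>\<^bsub>G\<^esub> j}
    :: ('a \<times> 'a \<Rightarrow> 'k) set set"
  let ?I = "module.span class_ring (exterior_square ?T) ?E"
  interpret N: lie_algebra "class_ring :: 'k ring" "free_nilpotent_lie_algebra ?T"
    by (rule lie_algebra_free_nilpotent)
  interpret V: module "class_ring :: 'k ring" "vertex_space ?T" by (rule module_func_space)
  interpret I: submodule "class_ring :: 'k ring" ?I "exterior_square ?T"
    by (rule module.span_is_submodule[OF module_exterior_square]) (auto simp: wedge_in_carrier)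
  have I: "edge_ideal G = {\<zero>\<^bsub>vertex_space ?T\<^esub>} \<times> ?I"
    by (auto simp: edge_ideal_def inj2_def)
  show ?thesis
  proof unfold_locales
    show "edge_ideal G \<subseteq> carrier (free_nilpotent_lie_algebra ?T :: ('k, _) module)"
      using I.subset by (auto simp: I free_nilpotent_simps)
  qed (auto simp: I free_nilpotent_simps wedge_zero)
qed

theorem lie_algebra_graph: "lie_algebra (class_ring :: 'k::field ring) (graph_lie_algebra G)"
  unfolding graph_lie_algebra_def
  by (rule lie_ideal.lie_algebra_quotient[OF lie_ideal_edge_ideal])

end

theory Submission
  imports Defs
begin

text \<open>
  An isomorphism of the Lie algebras induces a linear isomorphism of the quotients by the derived
  algebras, which are the vertex spaces. It gives linearly independent vectors \<open>x i\<close>, indexed by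
  the vertices of the first graph, in the vertex space of the second one, and for an edge \<open>i j\<close> the
  minor of \<open>x i\<close>, \<open>x j\<close> at any two nonadjacent vertices of the second graph vanishes.

  If \<open>r\<close> is in the support of \<open>x i\<close>, an element of the centralizer of \<open>x i\<close> is determined by its
  coordinates in the star of \<open>r\<close>, so the degree of \<open>i\<close> is at most that of \<open>r\<close>; in case of equality
  every vertex in the support of \<open>x i\<close> has all neighbours of \<open>r\<close> in its star. By independence
  there is a bijection \<open>\<sigma>\<close> with \<open>\<sigma> i\<close> in the support of \<open>x i\<close>. Summing the degrees, also
  for the inverse isomorphism, shows that \<open>\<sigma>\<close> preserves them. If \<open>i\<close>, \<open>j\<close> are adjacent and \<open>\<sigma> i\<close>,
  \<open>\<sigma> j\<close> are not, then the vanishing minor puts \<open>\<sigma> i\<close> and \<open>\<sigma> j\<close> in the supports of both vectors,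
  hence \<open>\<sigma> i\<close> and \<open>\<sigma> j\<close> have equal links, and on the class of vertices with that link \<open>x i\<close>
  and \<open>x j\<close> are proportional. A choice of \<open>\<sigma>\<close> compatible with these classes rules this out.
\<close>

subsection \<open>Independent families of coordinate vectors\<close>

text \<open>Linear independence in K^R for finite \<open>I\<close>, as an indexed family: repeated
  vectors are dependent. The vectors are read only on \<open>R\<close>, so dropping coordinates is a
  change of \<open>R\<close>.\<close>

definition independent_family :: "'i set \<Rightarrow> 'r set \<Rightarrow> ('i \<Rightarrow> 'r \<Rightarrow> 'k::field) \<Rightarrow> bool" where
  "independent_family I R x \<longleftrightarrow>
     (\<forall>c. (\<forall>r\<in>R. (\<Sum>i\<in>I. c i * x i r) = 0) \<longrightarrow> (\<forall>i\<in>I. c i = 0))"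

lemma independent_familyD:
  assumes "independent_family I R x" and "\<And>r. r \<in> R \<Longrightarrow> (\<Sum>i\<in>I. c i * x i r) = 0" and "i \<in> I"
  shows "c i = 0"
  using assms unfolding independent_family_def by blast

lemma independent_family_cong:
  assumes "\<And>i r. i \<in> I \<Longrightarrow> r \<in> R \<Longrightarrow> x i r = y i r"
  shows "independent_family I R x \<longleftrightarrow> independent_family I R y"
proof -
  have "(\<Sum>i\<in>I. c i * x i r) = (\<Sum>i\<in>I. c i * y i r)" if "r \<in> R" for c r
    using assms that by (intro sum.cong) auto
  then show ?thesis by (simp add: independent_family_def)
qed

lemma independent_family_subset:
  assumes "independent_family I R x" and "J \<subseteq> I" and "finite I"
  shows "independent_family J R x"
  unfolding independent_family_def
proof (intro allI impI ballI)
  fix c j assume c: "\<forall>r\<in>R. (\<Sum>i\<in>J. c i * x i r) = 0" and j: "j \<in> J"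
  let ?d = "\<lambda>i. if i \<in> J then c i else 0"
  have "(\<Sum>i\<in>I. ?d i * x i r) = (\<Sum>i\<in>J. c i * x i r)" for r
    using assms(2,3) by (intro sum.mono_neutral_cong_right) auto
  then show "c j = 0" using independent_familyD[OF assms(1), of ?d j] c j assms(2) by auto
qed

lemma independent_family_column_nonzero:
  assumes "independent_family I R x" and "i \<in> I" and "finite I"
  obtains r where "r \<in> R" "x i r \<noteq> 0"
proof -
  have "\<exists>r\<in>R. x i r \<noteq> 0"
  proof (rule ccontr)
    assume "\<not> ?thesis"
    then have "(\<Sum>l\<in>I. (if l = i then 1 else 0) * x l r) = 0" if "r \<in> R" for r
      using that assms(2,3) by (auto intro!: sum.neutral)
    from independent_familyD[OF assms(1) this assms(2)] show False by simp
  qed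
  then show ?thesis using that by blast
qed

lemma independent_family_not_proportional:
  assumes x: "independent_family I R x" and I: "finite I" "i \<in> I" "j \<in> I" "i \<noteq> j"
    and propor: "\<And>r. r \<in> R \<Longrightarrow> x j r = a * x i r"
  shows False
proof -
  let ?c = "\<lambda>l. if l = i then a else if l = j then - 1 else 0"
  have "(\<Sum>l\<in>I. ?c l * x l r) = 0" if "r \<in> R" for r
  proof -
    have "(\<Sum>l\<in>I. ?c l * x l r) = (\<Sum>l\<in>{i, j}. ?c l * x l r)"
      using I by (intro sum.mono_neutral_right) auto
    then show ?thesis using I propor[OF that] by simp
  qed
  from independent_familyD[OF x this I(3)] show False using I by simp
qed

section \<open>Cutting independent vectors down to classes of coordinates\<close>

text \<open>Multilinearity of the determinant in one vector, phrased without determinants: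
  \<open>x k\<close> is the sum of its pieces on the fibres of \<open>\<kappa>\<close>. If no piece
  could replace it, every piece, and hence \<open>x k\<close>, would lie in the span of the other
  vectors.\<close>

lemma split_column:
  fixes x :: "'i \<Rightarrow> 'r \<Rightarrow> 'k::field"
  assumes x: "independent_family I R x" and I: "finite I" "k \<in> I" and R: "finite R"
  shows "\<exists>q. independent_family I R (x(k := \<lambda>r. if \<kappa> r = q then x k r else 0))"
proof (rule ccontr)
  assume neg: "\<not> ?thesis"
  let ?y = "\<lambda>q. x(k := \<lambda>r. if \<kappa> r = q then x k r else 0)"
  have sum_k: "(\<Sum>i\<in>I. f i) = f k + (\<Sum>i\<in>I - {k}. f i)" for f :: "'i \<Rightarrow> 'k"
    using I by (simp add: sum.remove)
  have "\<exists>d. \<forall>r\<in>R. (if \<kappa> r = q then x k r else 0) = (\<Sum>i\<in>I - {k}. d i * x i r)" for q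
  proof -
    from neg have "\<not> independent_family I R (?y q)" by blast
    then obtain c i where c: "\<And>r. r \<in> R \<Longrightarrow> (\<Sum>i\<in>I. c i * ?y q i r) = 0" and i: "i \<in> I" "c i \<noteq> 0"
      unfolding independent_family_def by blast
    have eq: "c k * (if \<kappa> r = q then x k r else 0) + (\<Sum>i\<in>I - {k}. c i * x i r) = 0" if "r \<in> R" for r
    proof -
      have "(\<Sum>i\<in>I - {k}. c i * ?y q i r) = (\<Sum>i\<in>I - {k}. c i * x i r)"
        by (intro sum.cong) auto
      then show ?thesis using c[OF that] unfolding sum_k by simp
    qed
    \<comment> \<open>With \<open>c k = 0\<close> the relation would not involve the replaced vector
      and would be a nontrivial relation of the original family.\<close>
    have ck: "c k \<noteq> 0"
    proof
      assume "c k = 0"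
      then have "(\<Sum>i\<in>I. c i * x i r) = 0" if "r \<in> R" for r
        using eq[OF that] unfolding sum_k by simp
      from independent_familyD[OF x this i(1)] i(2) show False by simp
    qed
    show ?thesis
    proof (intro exI ballI)
      fix r assume "r \<in> R"
      have "(\<Sum>i\<in>I - {k}. (- c i / c k) * x i r) = - (\<Sum>i\<in>I - {k}. c i * x i r) / c k"
        by (simp add: sum_negf sum_divide_distrib)
      also have "\<dots> = (if \<kappa> r = q then x k r else 0)"
        using eq[OF \<open>r \<in> R\<close>] ck by (simp add: divide_simps add_eq_0_iff split: if_splits)
      finally show "(if \<kappa> r = q then x k r else 0) = (\<Sum>i\<in>I - {k}. (- c i / c k) * x i r)" ..
    qed
  qed
  then obtain d where d: "\<And>q r. r \<in> R \<Longrightarrow>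
      (if \<kappa> r = q then x k r else 0) = (\<Sum>i\<in>I - {k}. d q i * x i r)"
    by metis
  \<comment> \<open>The representations of the pieces, summed over the fibres that meet
    \<open>R\<close>, represent \<open>x k\<close> by the other vectors.\<close>
  let ?c = "\<lambda>i. if i = k then - 1 else \<Sum>q\<in>\<kappa> ` R. d q i"
  have "(\<Sum>i\<in>I. ?c i * x i r) = 0" if r: "r \<in> R" for r
  proof -
    have "x k r = (\<Sum>q\<in>\<kappa> ` R. if \<kappa> r = q then x k r else 0)"
      using R r by simp
    also have "\<dots> = (\<Sum>i\<in>I - {k}. (\<Sum>q\<in>\<kappa> ` R. d q i) * x i r)"
      unfolding d[OF r] by (subst sum.swap) (simp add: sum_distrib_right)
    also have "\<dots> = (\<Sum>i\<in>I - {k}. ?c i * x i r)" by (intro sum.cong) auto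
    finally show ?thesis unfolding sum_k by simp
  qed
  from independent_familyD[OF x this I(2)] show False by simp
qed

text \<open>\<open>split_column\<close> applied to one vector after another. With the identity as
  \<open>\<kappa>\<close> it yields transversals, with links as \<open>\<kappa>\<close> the
  restriction to classes of vertices.\<close>

lemma split_columns:
  assumes x: "independent_family I R x" and I: "finite I" and R: "finite R"
  shows "\<exists>\<phi>. independent_family I R (\<lambda>i r. if \<kappa> r = \<phi> i then x i r else 0)"
proof -
  \<comment> \<open>\<open>J\<close> collects the vectors already cut; the others are still
    whole.\<close>
  have "\<exists>\<phi>. independent_family I R (\<lambda>i r. if i \<in> J \<longrightarrow> \<kappa> r = \<phi> i then x i r else 0)"
    if "finite J" "J \<subseteq> I" for J
    using that
  proof (induction J)
    case empty
    then show ?case using x by simp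
  next
    case (insert k J)
    then obtain \<phi> where \<phi>:
      "independent_family I R (\<lambda>i r. if i \<in> J \<longrightarrow> \<kappa> r = \<phi> i then x i r else 0)" (is "independent_family I R ?y")
      by auto
    obtain q where "independent_family I R (?y(k := \<lambda>r. if \<kappa> r = q then ?y k r else 0))"
      using split_column[OF \<phi> I _ R, of k \<kappa>] insert.prems by auto
    also have "?y(k := \<lambda>r. if \<kappa> r = q then ?y k r else 0) =
        (\<lambda>i r. if i \<in> insert k J \<longrightarrow> \<kappa> r = (\<phi>(k := q)) i then x i r else 0)"
      using insert.hyps by (auto simp: fun_eq_iff)
    finally show ?case by (rule exI[of _ "\<phi>(k := q)"])
  qed
  from this[OF I] obtain \<phi> where
    "independent_family I R (\<lambda>i r. if i \<in> I \<longrightarrow> \<kappa> r = \<phi> i then x i r else 0)" by blast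
  then show ?thesis
    using independent_family_cong[of I R "\<lambda>i r. if i \<in> I \<longrightarrow> \<kappa> r = \<phi> i then x i r else 0"
        "\<lambda>i r. if \<kappa> r = \<phi> i then x i r else 0"] by auto
qed

text \<open>Cutting along the identity leaves each vector at most one nonzero coordinate. By
  independence this coordinate exists, and two vectors cannot share it, being proportional then. It
  amounts to picking a nonzero term in the expansion of a minor.\<close>

lemma independent_transversal:
  assumes x: "independent_family I R x" and I: "finite I" and R: "finite R"
  shows "\<exists>\<sigma>. inj_on \<sigma> I \<and> (\<forall>i\<in>I. \<sigma> i \<in> R \<and> x i (\<sigma> i) \<noteq> 0)"
proof -
  obtain \<sigma> where \<sigma>: "independent_family I R (\<lambda>i r. if r = \<sigma> i then x i r else 0)"
    using split_columns[OF assms, of "\<lambda>r. r"] by blast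
  have nz: "\<sigma> i \<in> R \<and> x i (\<sigma> i) \<noteq> 0" if "i \<in> I" for i
    by (rule independent_family_column_nonzero[OF \<sigma> that I]) (auto split: if_splits)
  have "inj_on \<sigma> I"
  proof (rule inj_onI, rule ccontr)
    fix i j assume ij: "i \<in> I" "j \<in> I" "\<sigma> i = \<sigma> j" "i \<noteq> j"
    show False
      by (rule independent_family_not_proportional[OF \<sigma> I ij(1,2,4), of "x j (\<sigma> j) / x i (\<sigma> j)"])
        (use ij nz[OF ij(1)] in auto)
  qed
  with nz show ?thesis by blast
qed

lemma independent_family_card_le:
  assumes "independent_family I R x" and "finite I" and "finite R"
  shows "card I \<le> card R"
proof -
  obtain \<sigma> where "inj_on \<sigma> I" "\<And>i. i \<in> I \<Longrightarrow> \<sigma> i \<in> R"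
    using independent_transversal[OF assms] by blast
  then show ?thesis using assms(3) by (intro card_inj_on_le[of \<sigma>]) auto
qed

subsection \<open>Families of commuting vectors\<close>

locale simple_graph =
  fixes T :: "'a set" and adj :: "'a \<Rightarrow> 'a \<Rightarrow> bool"
  assumes finite_vertices: "finite T"
    and adj_sym: "adj i j \<Longrightarrow> adj j i"
    and adj_irrefl: "\<not> adj i i"
    and adj_vertex: "adj i j \<Longrightarrow> i \<in> T"
begin

definition link :: "'a \<Rightarrow> 'a set" where
  "link i = {j. adj i j}"

abbreviation star :: "'a \<Rightarrow> 'a set" where
  "star i \<equiv> insert i (link i)"

lemma link_subset: "link i \<subseteq> T"
  using adj_sym adj_vertex by (auto simp: link_def)

lemma finite_link: "finite (link i)"
  using finite_subset[OF link_subset finite_vertices] .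

lemma card_star: "card (star i) = Suc (card (link i))"
  using finite_link by (simp add: link_def adj_irrefl)

end

text \<open>\<open>x i\<close> stands for the image of the vertex \<open>i\<close> modulo the
  exterior part. \<open>commute\<close> says that the wedge of the images of adjacent vertices has
  no component at a nonadjacent pair. It concerns adjacent \<open>i\<close>, \<open>j\<close> only;
  the reverse implication will come from counting degrees.\<close>

locale commuting_family = G: simple_graph T adj + H: simple_graph T' adj'
  for T :: "'a set" and adj and T' :: "'b set" and adj' +
  fixes x :: "'a \<Rightarrow> 'b \<Rightarrow> 'k::field"
  assumes independent: "independent_family T T' x"
    and commute: "\<lbrakk>adj i j; k \<in> T'; l \<in> T'; k \<noteq> l; \<not> adj' k l\<rbrakk> \<Longrightarrow> x i k * x j l = x i l * x j k"
begin

lemma commute_star: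
  assumes "p \<in> G.star i" and "k \<in> T'" "l \<in> T'" "k \<noteq> l" "\<not> adj' k l"
  shows "x i k * x p l = x i l * x p k"
  using assms commute by (auto simp: G.link_def mult.commute)

text \<open>The vectors \<open>x p\<close> with \<open>p\<close> in the star of \<open>i\<close> lie in the centralizer of \<open>x i\<close>. If the
  elements \<open>w\<close> of that centralizer are determined by their coordinates in \<open>S\<close>, then its dimension is
  at most \<open>card S\<close>.\<close>

lemma card_star_le_if_determined:
  assumes i: "i \<in> T" and S: "S \<subseteq> T'"
    and det: "\<And>w. \<lbrakk>\<And>k l. \<lbrakk>k \<in> T'; l \<in> T'; k \<noteq> l; \<not> adj' k l\<rbrakk> \<Longrightarrow> x i k * w l = x i l * w k;
        \<And>s. s \<in> S \<Longrightarrow> w s = 0\<rbrakk> \<Longrightarrow> \<forall>l\<in>T'. w l = 0"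
  shows "card (G.star i) \<le> card S"
proof (rule independent_family_card_le)
  have sub: "G.star i \<subseteq> T" using i G.link_subset by auto
  have ind: "independent_family (G.star i) T' x"
    by (rule independent_family_subset[OF independent sub G.finite_vertices])
  show "independent_family (G.star i) S x"
    unfolding independent_family_def
  proof (intro allI impI)
    fix c assume c: "\<forall>s\<in>S. (\<Sum>p\<in>G.star i. c p * x p s) = 0"
    \<comment> \<open>A combination of centralizing vectors centralizes \<open>x i\<close>. If it
      vanishes on \<open>S\<close>, it vanishes on \<open>T'\<close> by \<open>det\<close>, and
      independence over \<open>T'\<close> applies.\<close>
    let ?w = "\<lambda>l. \<Sum>p\<in>G.star i. c p * x p l"
    have "\<forall>l\<in>T'. ?w l = 0"
    proof (rule det)
      fix k l assume kl: "k \<in> T'" "l \<in> T'" "k \<noteq> l" "\<not> adj' k l"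
      have "x i k * ?w l = (\<Sum>p\<in>G.star i. c p * (x i k * x p l))"
        by (simp only: sum_distrib_left mult.left_commute)
      also have "\<dots> = (\<Sum>p\<in>G.star i. c p * (x i l * x p k))"
        using commute_star kl by (intro sum.cong) auto
      also have "\<dots> = x i l * ?w k"
        by (simp only: sum_distrib_left mult.left_commute)
      finally show "x i k * ?w l = x i l * ?w k" .
    qed (use c in blast)
    then show "\<forall>p\<in>G.star i. c p = 0"
      using independent_familyD[OF ind] by blast
  qed
  show "finite (G.star i)" "finite S"
    using G.finite_link finite_subset[OF S H.finite_vertices] by auto
qed

text \<open>For \<open>l\<close> outside the star of \<open>r\<close> the relation
  \<open>x i r * w l = x i l * w r\<close> holds, where \<open>w r = 0\<close> and
  \<open>x i r\<close> is nonzero.\<close>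

lemma card_star_le:
  assumes i: "i \<in> T" and r: "r \<in> T'" "x i r \<noteq> 0"
  shows "card (G.star i) \<le> card (H.star r)"
proof (rule card_star_le_if_determined[OF i])
  fix w assume comm: "\<And>k l. \<lbrakk>k \<in> T'; l \<in> T'; k \<noteq> l; \<not> adj' k l\<rbrakk> \<Longrightarrow> x i k * w l = x i l * w k"
    and 0: "\<And>s. s \<in> H.star r \<Longrightarrow> w s = 0"
  show "\<forall>l\<in>T'. w l = 0"
    using comm[of r] 0 r by (fastforce simp: H.link_def)
qed (use r H.link_subset in auto)

text \<open>Otherwise some neighbour \<open>p\<close> of \<open>r\<close> lies outside the star of
  \<open>q\<close>. The coordinate at \<open>p\<close> is then controlled by the one at
  \<open>q\<close>, so the star of \<open>r\<close> without \<open>p\<close> already determines the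
  centralizer and is too small for \<open>eq\<close>.\<close>

lemma support_dominates:
  assumes i: "i \<in> T" and r: "r \<in> T'" "x i r \<noteq> 0" and eq: "card (G.star i) = card (H.star r)"
    and q: "q \<in> T'" "x i q \<noteq> 0"
  shows "H.link r \<subseteq> H.star q"
proof (rule ccontr)
  assume "\<not> ?thesis"
  then obtain p where p: "adj' r p" "p \<noteq> q" "\<not> adj' q p" by (auto simp: H.link_def)
  have pT: "p \<in> T'" and pr: "p \<noteq> r" using p H.adj_vertex H.adj_sym H.adj_irrefl by blast+
  have "card (G.star i) \<le> card (H.star r - {p})"
  proof (rule card_star_le_if_determined[OF i])
    fix w assume comm: "\<And>k l. \<lbrakk>k \<in> T'; l \<in> T'; k \<noteq> l; \<not> adj' k l\<rbrakk> \<Longrightarrow> x i k * w l = x i l * w k"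
      and 0: "\<And>s. s \<in> H.star r - {p} \<Longrightarrow> w s = 0"
    \<comment> \<open>\<open>r\<close> itself stays in the smaller set, so it still forces all
      coordinates except the one at \<open>p\<close>.\<close>
    have *: "w l = 0" if "l \<in> T'" "l \<noteq> p" for l
      using comm[of r l] 0[of l] 0[of r] that r pr by (fastforce simp: H.link_def)
    moreover have "w p = 0" using comm[of q p] *[of q] q p pT by auto
    ultimately show "\<forall>l\<in>T'. w l = 0" by metis
  qed (use r H.link_subset in auto)
  also have "\<dots> < card (H.star r)"
    using p H.finite_link by (intro psubset_card_mono) (auto simp: H.link_def)
  finally show False using eq by simp
qed

lemma card_vertices_le: "card T \<le> card T'"
  by (rule independent_family_card_le[OF independent G.finite_vertices H.finite_vertices])

lemma sum_card_star_le:
  "(\<Sum>i\<in>T. card (G.star i)) \<le> (\<Sum>r\<in>T'. card (H.star r))"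
proof -
  obtain \<sigma> where \<sigma>: "inj_on \<sigma> T" "\<And>i. i \<in> T \<Longrightarrow> \<sigma> i \<in> T'" "\<And>i. i \<in> T \<Longrightarrow> x i (\<sigma> i) \<noteq> 0"
    using independent_transversal[OF independent G.finite_vertices H.finite_vertices] by blast
  have "(\<Sum>i\<in>T. card (G.star i)) \<le> (\<Sum>i\<in>T. card (H.star (\<sigma> i)))"
    using \<sigma> by (intro sum_mono card_star_le) auto
  also have "\<dots> = (\<Sum>r\<in>\<sigma> ` T. card (H.star r))" using \<sigma>(1) by (simp add: sum.reindex)
  also have "\<dots> \<le> (\<Sum>r\<in>T'. card (H.star r))"
    using \<sigma>(2) H.finite_vertices by (intro sum_mono2) auto
  finally show ?thesis .
qed

text \<open>An arbitrary transversal may send an edge to two nonadjacent vertices with equal links. To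
  exclude this, the vectors are first restricted to the classes of vertices with equal links.\<close>

theorem graph_isomorphism:
  assumes card: "card T' \<le> card T"
    and sum: "(\<Sum>r\<in>T'. card (H.star r)) \<le> (\<Sum>i\<in>T. card (G.star i))"
  shows "\<exists>\<sigma>. bij_betw \<sigma> T T' \<and> (\<forall>i\<in>T. \<forall>j\<in>T. adj' (\<sigma> i) (\<sigma> j) \<longleftrightarrow> adj i j)"
proof -
  obtain \<phi> where \<phi>:
    "independent_family T T' (\<lambda>i r. if H.link r = \<phi> i then x i r else 0)"
    using split_columns[OF independent G.finite_vertices H.finite_vertices, of H.link] ..
  \<comment> \<open>A transversal of the cut family: \<open>\<sigma> i\<close> is in the support of
    \<open>x i\<close> and also in the class that \<open>\<phi> i\<close> selects.\<close>
  obtain \<sigma> where \<sigma>: "inj_on \<sigma> T" "\<And>i. i \<in> T \<Longrightarrow> \<sigma> i \<in> T'"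
    and \<sigma>\<phi>: "\<forall>i\<in>T. (if H.link (\<sigma> i) = \<phi> i then x i (\<sigma> i) else 0) \<noteq> 0"
    using independent_transversal[OF \<phi> G.finite_vertices H.finite_vertices] by blast
  have nz: "x i (\<sigma> i) \<noteq> 0" and class_eq: "H.link (\<sigma> i) = \<phi> i" if "i \<in> T" for i
    using \<sigma>\<phi> that by (auto split: if_splits)
  have im: "\<sigma> ` T = T'"
    using \<sigma> card card_vertices_le H.finite_vertices
    by (intro card_subset_eq) (auto simp: card_image)
  then have bij: "bij_betw \<sigma> T T'" using \<sigma>(1) by (simp add: bij_betw_def)
  have le: "card (G.star i) \<le> card (H.star (\<sigma> i))" if "i \<in> T" for i
    using card_star_le \<sigma>(2) nz that by blast
  have sum_eq: "(\<Sum>i\<in>T. card (G.star i)) = (\<Sum>i\<in>T. card (H.star (\<sigma> i)))"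
    using sum sum_card_star_le sum.reindex_bij_betw[OF bij, of "\<lambda>r. card (H.star r)"] by simp
  \<comment> \<open>Termwise inequalities with equal sums are equalities; this is the case in which
    \<open>support_dominates\<close> applies.\<close>
  have eq: "card (G.star i) = card (H.star (\<sigma> i))" if "i \<in> T" for i
    by (rule sum_mono_inv[OF sum_eq]) (use le that G.finite_vertices in auto)
  have adj: "adj' (\<sigma> i) (\<sigma> j)" if ij: "adj i j" for i j
  proof (rule ccontr)
    assume nadj: "\<not> adj' (\<sigma> i) (\<sigma> j)"
    have T: "i \<in> T" "j \<in> T" and ne: "i \<noteq> j"
      using ij G.adj_vertex G.adj_sym G.adj_irrefl by blast+
    have nadj': "\<not> adj' (\<sigma> j) (\<sigma> i)" using nadj H.adj_sym by blast
    have \<sigma>ne: "\<sigma> i \<noteq> \<sigma> j" using \<sigma>(1) T ne by (auto dest: inj_onD)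
    have "x i (\<sigma> i) * x j (\<sigma> j) = x i (\<sigma> j) * x j (\<sigma> i)"
      by (rule commute[OF ij]) (use \<sigma> T \<sigma>ne nadj in auto)
    then have nz': "x i (\<sigma> j) \<noteq> 0" "x j (\<sigma> i) \<noteq> 0"
      using nz T by (metis mult_eq_0_iff)+
    have "H.link (\<sigma> i) \<subseteq> H.star (\<sigma> j)" "H.link (\<sigma> j) \<subseteq> H.star (\<sigma> i)"
      using support_dominates[OF T(1) \<sigma>(2)[OF T(1)] nz[OF T(1)] eq[OF T(1)] \<sigma>(2)[OF T(2)] nz'(1)]
        support_dominates[OF T(2) \<sigma>(2)[OF T(2)] nz[OF T(2)] eq[OF T(2)] \<sigma>(2)[OF T(1)] nz'(2)]
      by simp_all
    \<comment> \<open>By nonadjacency neither vertex is in the link of the other, so both inclusions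
      hold with links in place of stars.\<close>
    then have link: "H.link (\<sigma> i) = H.link (\<sigma> j)"
      using nadj nadj' by (auto simp: H.link_def)
    \<comment> \<open>Vertices with equal links are nonadjacent, since otherwise one would be in its
      own link. So the minor of \<open>x i\<close>, \<open>x j\<close> at \<open>\<sigma> i\<close>
      and \<open>l\<close> vanishes.\<close>
    have propor: "x j l = x j (\<sigma> i) / x i (\<sigma> i) * x i l" if l: "l \<in> T'" "H.link l = \<phi> i" for l
    proof (cases "l = \<sigma> i")
      case False
      have "\<not> adj' (\<sigma> i) l"
        using l(2) class_eq[OF T(1)] H.adj_irrefl by (auto simp: H.link_def)
      then have "x i (\<sigma> i) * x j l = x i l * x j (\<sigma> i)"
        by (intro commute[OF ij]) (use \<sigma>(2)[OF T(1)] l False in auto)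
      then show ?thesis using nz[OF T(1)] by (simp add: field_simps)
    qed (use nz[OF T(1)] in simp)
    \<comment> \<open>Equal links mean \<open>\<phi> i = \<phi> j\<close>, so both vectors are cut
      to the same class and are proportional there, against the independence of the cut
      family.\<close>
    show False
      by (rule independent_family_not_proportional[OF \<phi> G.finite_vertices T ne,
            of "x j (\<sigma> i) / x i (\<sigma> i)"])
        (use propor class_eq T link in auto)
  qed
  \<comment> \<open>\<open>adj\<close> gives one inclusion and equal degrees make it an equality, so
    that adjacency is also reflected.\<close>
  have link: "H.link (\<sigma> i) = \<sigma> ` G.link i" if i: "i \<in> T" for i
  proof (rule card_subset_eq[symmetric])
    show "\<sigma> ` G.link i \<subseteq> H.link (\<sigma> i)" using adj by (auto simp: G.link_def H.link_def)
    have "inj_on \<sigma> (G.link i)" using \<sigma>(1) G.link_subset by (blast intro: inj_on_subset)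
    then show "card (\<sigma> ` G.link i) = card (H.link (\<sigma> i))"
      using eq[OF i] by (simp add: card_image G.card_star H.card_star)
  qed (rule H.finite_link)
  have "adj i j" if "i \<in> T" "j \<in> T" "adj' (\<sigma> i) (\<sigma> j)" for i j
  proof -
    have "\<sigma> j \<in> \<sigma> ` G.link i" using link[OF that(1)] that(3) by (auto simp: H.link_def)
    then have "j \<in> G.link i"
      using \<sigma>(1) that(2) G.link_subset by (metis inj_on_image_mem_iff)
    then show ?thesis by (simp add: G.link_def)
  qed
  with bij adj show ?thesis by blast
qed

end

subsection \<open>Module homomorphisms\<close>

lemma module_homI:
  assumes "\<And>x. x \<in> carrier M \<Longrightarrow> f x \<in> carrier N"
    and "\<And>x y. \<lbrakk>x \<in> carrier M; y \<in> carrier M\<rbrakk> \<Longrightarrow> f (x \<oplus>\<^bsub>M\<^esub> y) = f x \<oplus>\<^bsub>N\<^esub> f y"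
    and "\<And>c x. \<lbrakk>c \<in> carrier R; x \<in> carrier M\<rbrakk> \<Longrightarrow> f (c \<odot>\<^bsub>M\<^esub> x) = c \<odot>\<^bsub>N\<^esub> f x"
  shows "f \<in> module_hom R M N"
  using assms by (auto simp: module_hom_def)

lemma module_hom_carrier:
  "\<lbrakk>f \<in> module_hom R M N; x \<in> carrier M\<rbrakk> \<Longrightarrow> f x \<in> carrier N"
  using module_hom_closed by blast

lemma module_hom_comp:
  assumes "f \<in> module_hom R M N" and "g \<in> module_hom R N P"
  shows "(\<lambda>x. g (f x)) \<in> module_hom R M P"
  using assms by (auto simp: module_hom_def Pi_iff)

lemma module_hom_zero:
  assumes "module R M" and "module R N" and "f \<in> module_hom R M N"
  shows "f \<zero>\<^bsub>M\<^esub> = \<zero>\<^bsub>N\<^esub>"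
proof -
  interpret mod_hom R M N f using assms by (intro mod_hom.intro mod_hom_axioms.intro)
  show ?thesis by (rule f0_is_0)
qed

lemma module_hom_inv_into:
  assumes M: "module R M" and f: "f \<in> module_hom R M N" and bij: "bij_betw f (carrier M) (carrier N)"
  shows "inv_into (carrier M) f \<in> module_hom R N M"
proof -
  interpret module R M by (rule M)
  let ?g = "inv_into (carrier M) f"
  have g: "?g y \<in> carrier M" "f (?g y) = y" if "y \<in> carrier N" for y
    using bij that by (auto simp: bij_betw_def inv_into_into f_inv_into_f)
  have gf: "?g (f x) = x" if "x \<in> carrier M" for x
    using bij that by (simp add: bij_betw_def)
  show ?thesis
  proof (rule module_homI)
    fix x y assume xy: "x \<in> carrier N" "y \<in> carrier N"
    then have "x \<oplus>\<^bsub>N\<^esub> y = f (?g x \<oplus>\<^bsub>M\<^esub> ?g y)"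
      using g by (simp add: module_hom_add[OF f])
    then show "?g (x \<oplus>\<^bsub>N\<^esub> y) = ?g x \<oplus>\<^bsub>M\<^esub> ?g y" using g xy by (simp add: gf)
  next
    fix c x assume cx: "c \<in> carrier R" "x \<in> carrier N"
    then have "c \<odot>\<^bsub>N\<^esub> x = f (c \<odot>\<^bsub>M\<^esub> ?g x)"
      using g by (simp add: module_hom_smult[OF f])
    then show "?g (c \<odot>\<^bsub>N\<^esub> x) = c \<odot>\<^bsub>M\<^esub> ?g x" using g cx by (simp add: gf)
  qed (rule g)
qed

lemma (in module) quotient_projection_hom:
  assumes "submodule R N M"
  shows "(\<lambda>x. N +>\<^bsub>M\<^esub> x) \<in> module_hom R M (quotient_module M N)"
  by (rule module_homI) (auto simp: carrier_quotient quotient_add[OF assms] quotient_smult[OF assms])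

lemma submodule_vimage:
  assumes M: "module R M" and N: "module R N" and f: "f \<in> module_hom R M N" and A: "submodule R A N"
  shows "submodule R {x \<in> carrier M. f x \<in> A} M"
proof -
  interpret M: module R M by (rule M)
  interpret A: submodule R A N by (rule A)
  show ?thesis
    by (rule submodule.intro[OF M])
      (auto simp: module_hom_add[OF f] module_hom_smult[OF f] module_hom_zero[OF M N f])
qed

lemma submodule_image:
  assumes M: "module R M" and N: "module R N" and f: "f \<in> module_hom R M N" and A: "submodule R A M"
  shows "submodule R (f ` A) N"
proof -
  interpret A: submodule R A M by (rule A)
  have AM: "a \<in> carrier M" if "a \<in> A" for a using that A.subset by auto
  show ?thesis
  proof (rule submodule.intro[OF N])
    show "f ` A \<subseteq> carrier N" using module_hom_carrier[OF f] AM by auto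
    show "\<zero>\<^bsub>N\<^esub> \<in> f ` A" using module_hom_zero[OF M N f] A.zero_closed by (metis imageI)
    show "v \<oplus>\<^bsub>N\<^esub> w \<in> f ` A" if vw: "v \<in> f ` A" "w \<in> f ` A" for v w
    proof -
      obtain a b where "a \<in> A" "b \<in> A" "v = f a" "w = f b" using vw by blast
      then show ?thesis using module_hom_add[OF f AM AM] A.m_closed by (metis imageI)
    qed
    show "c \<odot>\<^bsub>N\<^esub> v \<in> f ` A" if cv: "c \<in> carrier R" "v \<in> f ` A" for c v
    proof -
      obtain a where "a \<in> A" "v = f a" using cv by blast
      then show ?thesis using module_hom_smult[OF f cv(1) AM] A.smult_closed[OF cv(1)] by (metis imageI)
    qed
  qed
qed

text \<open>The preimage of the right-hand span is a submodule containing \<open>A\<close>, and the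
  image of the left-hand span is one containing the image of \<open>A\<close>.\<close>

lemma image_span:
  assumes M: "module R M" and N: "module R N" and f: "f \<in> module_hom R M N" and A: "A \<subseteq> carrier M"
  shows "f ` module.span R M A = module.span R N (f ` A)"
proof
  interpret M: module R M by (rule M)
  interpret N: module R N by (rule N)
  have fA: "f ` A \<subseteq> carrier N" using A module_hom_carrier[OF f] by auto
  have "A \<subseteq> {x \<in> carrier M. f x \<in> N.span (f ` A)}"
    using A N.in_own_span[OF fA] by auto
  then have "M.span A \<subseteq> {x \<in> carrier M. f x \<in> N.span (f ` A)}"
    using M.span_is_subset submodule_vimage[OF M N f N.span_is_submodule[OF fA]] by blast
  then show "f ` M.span A \<subseteq> N.span (f ` A)" by auto
  show "N.span (f ` A) \<subseteq> f ` M.span A"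
    using N.span_is_subset[OF _ submodule_image[OF M N f M.span_is_submodule[OF A]]]
      M.in_own_span[OF A] by blast
qed

lemma image_coset:
  assumes f: "f \<in> module_hom R M N" and A: "A \<subseteq> carrier M" and x: "x \<in> carrier M"
  shows "f ` (A +>\<^bsub>M\<^esub> x) = f ` A +>\<^bsub>N\<^esub> f x"
  using module_hom_add[OF f _ x] A by (force simp: a_r_coset_def')

text \<open>Elements of the quotient are sets, so the induced map is the direct image and needs no
  representatives.\<close>

lemma quotient_image_hom:
  assumes M: "module R M" and N: "module R N" and f: "f \<in> module_hom R M N" and A: "submodule R A M"
  shows "(`) f \<in> module_hom R (quotient_module M A) (quotient_module N (f ` A))"
proof -
  interpret M: module R M by (rule M)
  interpret N: module R N by (rule N)
  note B = submodule_image[OF M N f A]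
  note im = image_coset[OF f submodule.subset[OF A]]
  show ?thesis
    by (rule module_homI)
      (auto simp: carrier_quotient im M.quotient_add[OF A] N.quotient_add[OF B] M.quotient_smult[OF A]
        N.quotient_smult[OF B] module_hom_carrier[OF f] module_hom_add[OF f] module_hom_smult[OF f] del: equalityI)
qed

lemma quotient_image_bij:
  assumes M: "module R M" and f: "f \<in> module_hom R M N" and A: "submodule R A M"
    and bij: "bij_betw f (carrier M) (carrier N)"
  shows "bij_betw ((`) f) (carrier (quotient_module M A)) (carrier (quotient_module N (f ` A)))"
proof -
  interpret M: module R M by (rule M)
  note im = image_coset[OF f submodule.subset[OF A]]
  interpret A: abelian_subgroup A M by (rule M.abelian_subgroup_submodule[OF A])
  have sub: "X \<subseteq> carrier M" if "X \<in> carrier (quotient_module M A)" for X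
    using that A.a_subset by (auto simp: carrier_quotient a_r_coset_def')
  have "inj_on ((`) f) (carrier (quotient_module M A))"
    using bij sub by (intro inj_onI) (metis bij_betw_def inj_on_image_eq_iff)
  moreover have "(`) f ` carrier (quotient_module M A) = carrier (quotient_module N (f ` A))"
    unfolding carrier_quotient bij_betw_imp_surj_on[OF bij, symmetric] image_image
    by (intro image_cong) (auto simp: im)
  ultimately show ?thesis by (simp add: bij_betw_def)
qed

subsection \<open>Coordinates\<close>

text \<open>Expansion in the basis of vertex vectors. Any finite index set is allowed, so tensor
  squares are covered as function spaces on pairs.\<close>

lemma hom_func_space_expand:
  fixes v :: "'s \<Rightarrow> 'k::field"
  assumes h: "h \<in> module_hom (class_ring :: 'k ring) (vertex_space S) (vertex_space R)"
    and S: "finite S" and v: "v \<in> carrier (vertex_space S)" and r: "r \<in> R"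
  shows "h v r = (\<Sum>s\<in>S. v s * h (vertex_vector S s) r)"
proof -
  \<comment> \<open>The part of \<open>v\<close> on \<open>F\<close>, built up one basis vector at a
    time.\<close>
  define u where "u F = (\<lambda>s\<in>S. if s \<in> F then v s else 0)" for F
  have c: "u F \<in> carrier (vertex_space S)" for F by (simp add: u_def func_space_simps)
  have "h (u F) r = (\<Sum>s\<in>F. v s * h (vertex_vector S s) r)" if "finite F" "F \<subseteq> S" for F
    using that
  proof (induction F)
    case empty
    have "u {} = \<zero>\<^bsub>vertex_space S\<^esub>" by (simp add: u_def func_space_simps)
    then have "h (u {}) = \<zero>\<^bsub>vertex_space R\<^esub>"
      using module_hom_zero[OF module_func_space module_func_space h] by simp
    then show ?case using r by (simp add: func_space_simps)
  next
    case (insert s F)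
    let ?e = "v s \<odot>\<^bsub>vertex_space S\<^esub> vertex_vector S s"
    have e: "?e \<in> carrier (vertex_space S)" by (simp add: func_space_simps)
    have "u (insert s F) = ?e \<oplus>\<^bsub>vertex_space S\<^esub> u F"
      using insert by (auto simp: u_def func_space_simps vertex_vector_def fun_eq_iff)
    moreover have "h ?e = v s \<odot>\<^bsub>vertex_space R\<^esub> h (vertex_vector S s)"
      by (rule module_hom_smult[OF h _ vertex_vector_in_carrier]) simp
    ultimately have "h (u (insert s F)) =
        (v s \<odot>\<^bsub>vertex_space R\<^esub> h (vertex_vector S s)) \<oplus>\<^bsub>vertex_space R\<^esub> h (u F)"
      by (simp only: module_hom_add[OF h e c])
    then show ?case using insert r by (simp add: func_space_simps)
  qed
  from this[OF S order_refl] have "h (u S) r = (\<Sum>s\<in>S. v s * h (vertex_vector S s) r)" .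
  also have "u S = v"
    using v by (auto simp: u_def func_space_simps fun_eq_iff PiE_def extensional_def)
  finally show ?thesis .
qed

lemma tensor_vertex_vector:
  "\<lbrakk>k \<in> T; l \<in> T\<rbrakk> \<Longrightarrow> tensor T (vertex_vector T k) (vertex_vector T l) = vertex_vector (T \<times> T) (k, l)"
  by (auto simp: tensor_def vertex_vector_def fun_eq_iff)

text \<open>The tensors with this symmetry form a submodule that contains all squares, in every
  characteristic.\<close>

lemma square_tensors_symmetric:
  fixes t :: "'a \<times> 'a \<Rightarrow> 'k::field"
  assumes "t \<in> square_tensors T" and "k \<in> T" "l \<in> T"
  shows "t (k, l) = t (l, k)"
proof -
  let ?N = "{t \<in> carrier (tensor_square T). t (k, l) = t (l, k)} :: ('a \<times> 'a \<Rightarrow> 'k) set"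
  have "submodule class_ring ?N (tensor_square T)"
    using assms(2,3) by (intro submodule.intro[OF module_func_space]) (auto simp: func_space_simps)
  then have "square_tensors T \<subseteq> ?N"
    unfolding square_tensors_def using assms(2,3)
    by (intro module.span_is_subset[OF module_func_space]) (auto simp: tensor_in_carrier, auto simp: tensor_def)
  with assms(1) show ?thesis by blast
qed

text \<open>The functional \<open>t (k, l) - t (l, k)\<close> kills square tensors, hence descends
  to the exterior square, where it reads off the component at the pair \<open>k\<close>,
  \<open>l\<close>. It vanishes on the wedges of edges. The submodule \<open>?A\<close> is its
  kernel.\<close>

lemma wedge_in_edge_span:
  fixes v w :: "'a \<Rightarrow> 'k::field"
  assumes mem: "wedge (verts G) v w \<in> module.span class_ring (exterior_square (verts G))
      {wedge (verts G) (vertex_vector (verts G) i) (vertex_vector (verts G) j) | i j. i \<rightarrow>\<^bsub>G\<^esub> j}"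
    and kl: "k \<in> verts G" "l \<in> verts G" "\<not> k \<rightarrow>\<^bsub>G\<^esub> l" "\<not> l \<rightarrow>\<^bsub>G\<^esub> k"
  shows "v k * w l = v l * w k"
proof -
  let ?T = "verts G"
  let ?A = "{t \<in> carrier (tensor_square ?T). t (k, l) = t (l, k)} :: ('a \<times> 'a \<Rightarrow> 'k) set"
  let ?p = "\<lambda>t. square_tensors ?T +>\<^bsub>tensor_square ?T\<^esub> t"
  have p: "?p \<in> module_hom class_ring (tensor_square ?T) (exterior_square ?T)"
    unfolding exterior_square_def
    by (rule module.quotient_projection_hom[OF module_func_space submodule_square_tensors])
  have A: "submodule class_ring ?A (tensor_square ?T)"
    using kl by (intro submodule.intro[OF module_func_space]) (auto simp: func_space_simps)
  \<comment> \<open>The basis tensor of an adjacent pair is zero at \<open>(k, l)\<close> and at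
    \<open>(l, k)\<close>.\<close>
  have "wedge ?T (vertex_vector ?T i) (vertex_vector ?T j) \<in> ?p ` ?A" if "i \<rightarrow>\<^bsub>G\<^esub> j" for i j
    unfolding wedge_def using that kl
    by (intro imageI CollectI conjI tensor_in_carrier) (auto simp: tensor_def vertex_vector_def)
  then have "module.span class_ring (exterior_square ?T)
      {wedge ?T (vertex_vector ?T i) (vertex_vector ?T j) | i j. i \<rightarrow>\<^bsub>G\<^esub> j} \<subseteq> ?p ` ?A"
    by (intro module.span_is_subset[OF module_exterior_square _
          submodule_image[OF module_func_space module_exterior_square p A]]) blast
  with mem obtain t where t: "t \<in> ?A" "?p (tensor ?T v w) = ?p t" unfolding wedge_def by blast
  interpret S: abelian_subgroup "square_tensors ?T" "tensor_square ?T :: ('k, _) module"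
    by (rule module.abelian_subgroup_submodule[OF module_func_space submodule_square_tensors])
  have "tensor ?T v w \<in> ?p t" using t(2) S.a_rcos_self[OF tensor_in_carrier] by metis
  then obtain s where "s \<in> square_tensors ?T" "tensor ?T v w = s \<oplus>\<^bsub>tensor_square ?T\<^esub> t"
    by (auto simp: a_r_coset_def')
  then have "tensor ?T v w (k, l) = tensor ?T v w (l, k)"
    using t(1) kl square_tensors_symmetric[of s ?T k l] by (simp add: func_space_simps)
  then show ?thesis using kl by (simp add: tensor_def)
qed

subsection \<open>Cosets of the edge ideal\<close>

lemma edge_ideal_eq:
  "edge_ideal G = {\<zero>\<^bsub>vertex_space (verts G)\<^esub>} \<times>
     (module.span class_ring (exterior_square (verts G))
       {wedge (verts G) (vertex_vector (verts G) i) (vertex_vector (verts G) j) | i j. i \<rightarrow>\<^bsub>G\<^esub> j}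
     :: ('a \<times> 'a \<Rightarrow> 'k::field) set set)"
  for G :: "('a, 'b) pre_digraph"
  by (auto simp: edge_ideal_def inj2_def)

abbreviation edge_coset ::
    "('a, 'b) pre_digraph \<Rightarrow> ('a \<Rightarrow> 'k::field) \<times> ('a \<times> 'a \<Rightarrow> 'k) set \<Rightarrow>
      (('a \<Rightarrow> 'k) \<times> ('a \<times> 'a \<Rightarrow> 'k) set) set" where
  "edge_coset G z \<equiv> edge_ideal G +>\<^bsub>free_nilpotent_lie_algebra (verts G)\<^esub> z"

text \<open>The projection of the graph Lie algebra onto the vertex space. The choice is harmless:
  all elements of a coset of the edge ideal have the same first component.\<close>

definition vertex_part :: "(('a \<Rightarrow> 'k) \<times> 'w) set \<Rightarrow> 'a \<Rightarrow> 'k" where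
  "vertex_part X = fst (SOME z. z \<in> X)"

context
  fixes G :: "('a, 'b) pre_digraph"
begin

private abbreviation "V \<equiv> vertex_space (verts G) :: ('k::field, 'a \<Rightarrow> 'k) module"
private abbreviation "W \<equiv> exterior_square (verts G) :: ('k::field, ('a \<times> 'a \<Rightarrow> 'k) set) module"
private abbreviation "N \<equiv> free_nilpotent_lie_algebra (verts G) ::
  ('k::field, ('a \<Rightarrow> 'k) \<times> ('a \<times> 'a \<Rightarrow> 'k) set) module"

lemma module_free_nilpotent: "module (class_ring :: 'k::field ring) N"
  by (rule lie_algebra.axioms(1)[OF lie_algebra_free_nilpotent, THEN vectorspace.axioms(1)])

lemma submodule_edge_ideal: "submodule (class_ring :: 'k::field ring) (edge_ideal G) N"
  by (rule lie_ideal.axioms(2)[OF lie_ideal_edge_ideal])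

lemma module_graph_lie_algebra: "module (class_ring :: 'k::field ring) (graph_lie_algebra G)"
  by (rule lie_algebra.axioms(1)[OF lie_algebra_graph, THEN vectorspace.axioms(1)])

lemma edge_coset_hom: "edge_coset G \<in> module_hom (class_ring :: 'k::field ring) N (graph_lie_algebra G)"
  unfolding graph_lie_algebra_def
  by (rule module.quotient_projection_hom[OF module_free_nilpotent submodule_edge_ideal])

lemma carrier_graph_lie_algebra:
  "carrier (graph_lie_algebra G) = edge_coset G ` (carrier V \<times> carrier W)"
  by (simp add: graph_lie_algebra_def carrier_quotient free_nilpotent_simps)

lemma edge_coset_bracket:
  assumes "v \<in> carrier V" "a \<in> carrier W" "w \<in> carrier V" "b \<in> carrier W"
  shows "edge_coset G (v, a) \<otimes>\<^bsub>graph_lie_algebra G\<^esub> edge_coset G (w, b) =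
    edge_coset G (\<zero>\<^bsub>V\<^esub>, wedge (verts G) v w)"
  using assms lie_ideal.quotient_bracket[OF lie_ideal_edge_ideal, of "(v, a)" G "(w, b)"]
  by (simp add: graph_lie_algebra_def free_nilpotent_simps)

lemma edge_coset_eq_zero_iff:
  assumes "z \<in> carrier N"
  shows "edge_coset G z = \<zero>\<^bsub>graph_lie_algebra G\<^esub> \<longleftrightarrow> z \<in> (edge_ideal G :: (_ \<times> ('a \<times> 'a \<Rightarrow> 'k::field) set) set)"
proof -
  interpret A: abelian_subgroup "edge_ideal G" N
    by (rule module.abelian_subgroup_submodule[OF module_free_nilpotent submodule_edge_ideal])
  have "\<zero>\<^bsub>graph_lie_algebra G\<^esub> = (edge_ideal G :: (_ \<times> ('a \<times> 'a \<Rightarrow> 'k) set) set)"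
    by (simp add: graph_lie_algebra_def quotient_module_def)
  then show ?thesis using A.a_rcos_self[OF assms] A.a_rcos_const by metis
qed

lemma vertex_part_edge_coset:
  fixes v :: "'a \<Rightarrow> 'k::field"
  assumes v: "v \<in> carrier V" and a: "a \<in> carrier W"
  shows "vertex_part (edge_coset G (v, a)) = v"
proof -
  interpret V: module "class_ring :: 'k ring" V by (rule module_func_space)
  interpret A: abelian_subgroup "edge_ideal G" "N :: ('k, _) module"
    by (rule module.abelian_subgroup_submodule[OF module_free_nilpotent submodule_edge_ideal])
  have "fst z = v" if "z \<in> edge_coset G (v, a)" for z
    using that v by (auto simp: a_r_coset_def' edge_ideal_eq free_nilpotent_simps)
  moreover have "(v, a) \<in> edge_coset G (v, a)"
    using A.a_rcos_self v a by (simp add: free_nilpotent_simps)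
  ultimately show ?thesis unfolding vertex_part_def by (metis someI)
qed

lemma vertex_part_hom: "vertex_part \<in> module_hom (class_ring :: 'k::field ring) (graph_lie_algebra G) V"
proof -
  interpret V: module "class_ring :: 'k ring" V by (rule module_func_space)
  interpret W: module "class_ring :: 'k ring" W by (rule module_exterior_square)
  have add: "edge_coset G z \<oplus>\<^bsub>graph_lie_algebra G\<^esub> edge_coset G z' = edge_coset G (z \<oplus>\<^bsub>N\<^esub> z')"
    if "z \<in> carrier N" "z' \<in> carrier N" for z z'
    using module_hom_add[OF edge_coset_hom that] ..
  have smult: "c \<odot>\<^bsub>graph_lie_algebra G\<^esub> edge_coset G z = edge_coset G (c \<odot>\<^bsub>N\<^esub> z)"
    if "z \<in> carrier N" for c z
    using module_hom_smult[OF edge_coset_hom _ that, of c] by simp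
  show ?thesis
    by (rule module_homI)
      (auto simp: carrier_graph_lie_algebra add smult free_nilpotent_simps vertex_part_edge_coset
        W.smult_closed[simplified] V.smult_closed[simplified])
qed

lemma vertex_part_eq_zero:
  assumes "X \<in> carrier (graph_lie_algebra G)" and "vertex_part X = \<zero>\<^bsub>V\<^esub>"
  obtains a where "a \<in> carrier W" "X = edge_coset G (\<zero>\<^bsub>V\<^esub>, a)"
proof -
  obtain v a where va: "v \<in> carrier V" "a \<in> carrier W" "X = edge_coset G (v, a)"
    using assms(1) unfolding carrier_graph_lie_algebra by blast
  with assms(2) have "v = \<zero>\<^bsub>V\<^esub>" using vertex_part_edge_coset by metis
  with va that show ?thesis by blast
qed

lemma vertex_inclusion_hom: "(\<lambda>v. (v, \<zero>\<^bsub>W\<^esub>)) \<in> module_hom (class_ring :: 'k::field ring) V N"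
proof -
  interpret W: module "class_ring :: 'k ring" W by (rule module_exterior_square)
  show ?thesis
    by (rule module_homI) (auto simp: free_nilpotent_simps W.smult_r_null[simplified])
qed

lemma exterior_inclusion_hom: "(\<lambda>a. (\<zero>\<^bsub>V\<^esub>, a)) \<in> module_hom (class_ring :: 'k::field ring) W N"
proof -
  interpret V: module "class_ring :: 'k ring" V by (rule module_func_space)
  show ?thesis
    by (rule module_homI) (auto simp: free_nilpotent_simps V.smult_r_null[simplified])
qed

end

subsection \<open>From Lie algebras to graphs\<close>

lemma vertex_part_bracket:
  fixes X :: "(('a \<Rightarrow> 'k::field) \<times> ('a \<times> 'a \<Rightarrow> 'k) set) set"
  assumes "X \<in> carrier (graph_lie_algebra G)" "Y \<in> carrier (graph_lie_algebra G)"
  shows "vertex_part (X \<otimes>\<^bsub>graph_lie_algebra G\<^esub> Y) = \<zero>\<^bsub>vertex_space (verts G)\<^esub>"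
proof -
  interpret V: module "class_ring :: 'k ring" "vertex_space (verts G)" by (rule module_func_space)
  obtain v a w b where "v \<in> carrier (vertex_space (verts G))" "a \<in> carrier (exterior_square (verts G))"
    "w \<in> carrier (vertex_space (verts G))" "b \<in> carrier (exterior_square (verts G))"
    "X = edge_coset G (v, a)" "Y = edge_coset G (w, b)"
    using assms unfolding carrier_graph_lie_algebra by blast
  then show ?thesis
    using vertex_part_edge_coset[OF V.M.zero_closed wedge_in_carrier] by (simp add: edge_coset_bracket)
qed

lemma simple_graph_verts:
  assumes "graph G"
  shows "simple_graph (verts G) (\<lambda>i j. i \<rightarrow>\<^bsub>G\<^esub> j)"
proof -
  interpret graph G by (rule assms)
  show ?thesis
    by unfold_locales (auto intro: adj_not_same graph_symmetric dest: adj_in_verts)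
qed

text \<open>\<open>x i\<close> is the vertex part of the image under \<open>f\<close> of the class
  of \<open>i\<close>. Adjacent vertices have bracket zero, hence so do their images, and
  \<open>wedge_in_edge_span\<close> gives the vanishing minors. Independence holds because
  \<open>h\<close> undoes \<open>f\<close> and preserves the exterior part. Exchanging
  \<open>f\<close> and \<open>h\<close> yields the family for the inverse.\<close>

lemma commuting_family_of_lie_hom:
  fixes G :: "('a, 'b) pre_digraph" and H :: "('c, 'd) pre_digraph"
    and f :: "(('a \<Rightarrow> 'k::field) \<times> ('a \<times> 'a \<Rightarrow> 'k) set) set \<Rightarrow> (('c \<Rightarrow> 'k) \<times> ('c \<times> 'c \<Rightarrow> 'k) set) set"
  assumes G: "graph G" and H: "graph H"
    and f: "f \<in> module_hom (class_ring :: 'k ring) (graph_lie_algebra G) (graph_lie_algebra H)"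
    and f_bracket: "\<And>X Y. \<lbrakk>X \<in> carrier (graph_lie_algebra G); Y \<in> carrier (graph_lie_algebra G)\<rbrakk> \<Longrightarrow>
      f (X \<otimes>\<^bsub>graph_lie_algebra G\<^esub> Y) = f X \<otimes>\<^bsub>graph_lie_algebra H\<^esub> f Y"
    and h: "h \<in> module_hom (class_ring :: 'k ring) (graph_lie_algebra H) (graph_lie_algebra G)"
    and h_bracket: "\<And>X Y. \<lbrakk>X \<in> carrier (graph_lie_algebra H); Y \<in> carrier (graph_lie_algebra H)\<rbrakk> \<Longrightarrow>
      h (X \<otimes>\<^bsub>graph_lie_algebra H\<^esub> Y) = h X \<otimes>\<^bsub>graph_lie_algebra G\<^esub> h Y"
    and hf: "\<And>X. X \<in> carrier (graph_lie_algebra G) \<Longrightarrow> h (f X) = X"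
  shows "\<exists>x :: 'a \<Rightarrow> 'c \<Rightarrow> 'k. commuting_family (verts G) (\<lambda>i j. i \<rightarrow>\<^bsub>G\<^esub> j) (verts H) (\<lambda>i j. i \<rightarrow>\<^bsub>H\<^esub> j) x"
proof -
  let ?K = "class_ring :: 'k ring"
  let ?V = "vertex_space (verts G) :: ('k, _) module" and ?V' = "vertex_space (verts H) :: ('k, _) module"
  let ?W = "exterior_square (verts G) :: ('k, _) module" and ?W' = "exterior_square (verts H) :: ('k, _) module"
  let ?L = "graph_lie_algebra G :: ('k, _) module" and ?L' = "graph_lie_algebra H :: ('k, _) module"
  interpret G: graph G by (rule G)
  interpret H: graph H by (rule H)
  interpret V: module ?K ?V by (rule module_func_space)
  interpret V': module ?K ?V' by (rule module_func_space)
  interpret W: module ?K ?W by (rule module_exterior_square)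
  interpret W': module ?K ?W' by (rule module_exterior_square)
  note coset_carrier = module_hom_carrier[OF edge_coset_hom]
  define e where "e v = edge_coset G (v, \<zero>\<^bsub>?W\<^esub>)" for v :: "'a \<Rightarrow> 'k"
  define e' where "e' v = edge_coset H (v, \<zero>\<^bsub>?W'\<^esub>)" for v :: "'c \<Rightarrow> 'k"
  \<comment> \<open>\<open>g\<close> is the map induced by \<open>f\<close> on the vertex spaces.
    \<open>d\<close> records what \<open>h\<close> sends from the exterior part to vertices; it is
    taken on tensors, so that \<open>hom_func_space_expand\<close> applies.\<close>
  define g where "g v = vertex_part (f (e v))" for v
  define d where "d t = vertex_part (h (edge_coset H (\<zero>\<^bsub>?V'\<^esub>,
    square_tensors (verts H) +>\<^bsub>tensor_square (verts H)\<^esub> t)))" for t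
  have e: "e \<in> module_hom ?K ?V ?L"
    unfolding e_def by (rule module_hom_comp[OF vertex_inclusion_hom edge_coset_hom])
  have e': "e' \<in> module_hom ?K ?V' ?L'"
    unfolding e'_def by (rule module_hom_comp[OF vertex_inclusion_hom edge_coset_hom])
  have g: "g \<in> module_hom ?K ?V ?V'"
    unfolding g_def by (rule module_hom_comp[OF module_hom_comp[OF e f] vertex_part_hom])
  have proj: "(\<lambda>t. square_tensors (verts H) +>\<^bsub>tensor_square (verts H)\<^esub> t)
      \<in> module_hom ?K (tensor_square (verts H)) ?W'"
    unfolding exterior_square_def
    by (rule module.quotient_projection_hom[OF module_func_space submodule_square_tensors])
  have d: "d \<in> module_hom ?K (tensor_square (verts H)) ?V"
    unfolding d_def
    by (rule module_hom_comp[OF module_hom_comp[OF module_hom_comp[OF module_hom_comp[OF proj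
      exterior_inclusion_hom] edge_coset_hom] h] vertex_part_hom])

  \<comment> \<open>Basis tensors suffice. The wedge of two basis vectors is a bracket,
    \<open>h\<close> maps it to a bracket, and brackets have vertex part zero.\<close>
  have d_zero: "d t r = 0" if t: "t \<in> carrier (tensor_square (verts H))" and r: "r \<in> verts G" for t r
  proof -
    have "d (vertex_vector (verts H \<times> verts H) (k, l)) r = 0" if kl: "k \<in> verts H" "l \<in> verts H" for k l
    proof -
      let ?v = "vertex_vector (verts H) k" and ?w = "vertex_vector (verts H) l"
      have "d (vertex_vector (verts H \<times> verts H) (k, l)) =
          vertex_part (h (edge_coset H (\<zero>\<^bsub>?V'\<^esub>, wedge (verts H) ?v ?w)))"
        by (simp only: d_def wedge_def tensor_vertex_vector[OF kl])
      also have "edge_coset H (\<zero>\<^bsub>?V'\<^esub>, wedge (verts H) ?v ?w) = e' ?v \<otimes>\<^bsub>?L'\<^esub> e' ?w"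
        unfolding e'_def using edge_coset_bracket vertex_vector_in_carrier W'.M.zero_closed by metis
      also have "h \<dots> = h (e' ?v) \<otimes>\<^bsub>?L\<^esub> h (e' ?w)"
        by (intro h_bracket module_hom_carrier[OF e'] vertex_vector_in_carrier)
      also have "vertex_part \<dots> = \<zero>\<^bsub>?V\<^esub>"
        by (intro vertex_part_bracket module_hom_carrier[OF h] module_hom_carrier[OF e'] vertex_vector_in_carrier)
      finally show ?thesis using r by (simp add: func_space_simps)
    qed
    then show ?thesis
      using hom_func_space_expand[OF d _ t r] by (auto intro!: sum.neutral)
  qed

  \<comment> \<open>Here \<open>f (e v)\<close> lies in the exterior part, so by
    \<open>d_zero\<close> its image under \<open>h\<close>, which is \<open>e v\<close>, has vertex
    part zero.\<close>
  have g_inj: "v = \<zero>\<^bsub>?V\<^esub>" if v: "v \<in> carrier ?V" and gv: "g v = \<zero>\<^bsub>?V'\<^esub>" for v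
  proof -
    have "f (e v) \<in> carrier ?L'" by (intro module_hom_carrier[OF f] module_hom_carrier[OF e] v)
    then obtain b where b: "b \<in> carrier ?W'" "f (e v) = edge_coset H (\<zero>\<^bsub>?V'\<^esub>, b)"
      using vertex_part_eq_zero gv unfolding g_def by blast
    obtain t where t: "t \<in> carrier (tensor_square (verts H))"
      "b = square_tensors (verts H) +>\<^bsub>tensor_square (verts H)\<^esub> t"
      using b(1) unfolding exterior_square_def carrier_quotient by blast
    have "v = vertex_part (e v)"
      unfolding e_def using vertex_part_edge_coset[OF v W.M.zero_closed] ..
    also have "\<dots> = vertex_part (h (f (e v)))" using hf[OF module_hom_carrier[OF e v]] by simp
    also have "\<dots> = d t" by (simp only: b(2) t(2) d_def)
    finally have "v r = 0" if "r \<in> verts G" for r using d_zero[OF t(1) that] by simp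
    then show ?thesis using v by (auto simp: func_space_simps fun_eq_iff PiE_def extensional_def)
  qed

  have "independent_family (verts G) (verts H) (\<lambda>i. g (vertex_vector (verts G) i))"
    unfolding independent_family_def
  proof (intro allI impI ballI)
    fix c i assume c: "\<forall>r\<in>verts H. (\<Sum>i\<in>verts G. c i * g (vertex_vector (verts G) i) r) = 0"
      and i: "i \<in> verts G"
    let ?v = "restrict c (verts G)"
    have v: "?v \<in> carrier ?V" by (simp add: func_space_simps)
    have "g ?v r = 0" if "r \<in> verts H" for r
      using hom_func_space_expand[OF g G.finite_verts v that] c that by (simp cong: sum.cong)
    then have "g ?v = \<zero>\<^bsub>?V'\<^esub>"
      using module_hom_carrier[OF g v]
      by (auto simp: func_space_simps fun_eq_iff PiE_def extensional_def)
    from g_inj[OF v this] have "?v i = \<zero>\<^bsub>?V\<^esub> i" by (rule fun_cong)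
    then show "c i = 0" using i by (simp add: func_space_simps)
  qed
  moreover have "g (vertex_vector (verts G) i) k * g (vertex_vector (verts G) j) l =
      g (vertex_vector (verts G) i) l * g (vertex_vector (verts G) j) k"
    if ij: "i \<rightarrow>\<^bsub>G\<^esub> j" and kl: "k \<in> verts H" "l \<in> verts H" "\<not> k \<rightarrow>\<^bsub>H\<^esub> l" for i j k l
  proof -
    let ?v = "vertex_vector (verts G) i" and ?w = "vertex_vector (verts G) j"
    let ?S = "{wedge (verts G) (vertex_vector (verts G) i) (vertex_vector (verts G) j) | i j. i \<rightarrow>\<^bsub>G\<^esub> j}"
    have vw: "?v \<in> carrier ?V" "?w \<in> carrier ?V" by (rule vertex_vector_in_carrier)+
    have "wedge (verts G) ?v ?w \<in> module.span ?K ?W ?S"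
      using W.in_own_span[of ?S] wedge_in_carrier ij by blast
    then have "(\<zero>\<^bsub>?V\<^esub>, wedge (verts G) ?v ?w) \<in> edge_ideal G" by (simp add: edge_ideal_eq)
    then have "e ?v \<otimes>\<^bsub>?L\<^esub> e ?w = \<zero>\<^bsub>?L\<^esub>"
      unfolding e_def edge_coset_bracket[OF vw(1) W.M.zero_closed vw(2) W.M.zero_closed]
      by (subst edge_coset_eq_zero_iff) (simp_all add: free_nilpotent_simps wedge_in_carrier)
    then have zero: "f (e ?v) \<otimes>\<^bsub>?L'\<^esub> f (e ?w) = \<zero>\<^bsub>?L'\<^esub>"
      using f_bracket[OF module_hom_carrier[OF e vw(1)] module_hom_carrier[OF e vw(2)]]
        module_hom_zero[OF module_graph_lie_algebra module_graph_lie_algebra f] by simp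
    \<comment> \<open>\<open>f\<close> may add an exterior component to the image of a vertex; the
      bracket ignores it.\<close>
    have coset: "\<exists>a \<in> carrier ?W'. f (e u) = edge_coset H (g u, a)" if u: "u \<in> carrier ?V" for u
    proof -
      have "f (e u) \<in> carrier ?L'" by (intro module_hom_carrier[OF f] module_hom_carrier[OF e] u)
      then obtain u' a where a: "u' \<in> carrier ?V'" "a \<in> carrier ?W'" "f (e u) = edge_coset H (u', a)"
        unfolding carrier_graph_lie_algebra by blast
      moreover have "g u = u'" unfolding g_def a(3) by (rule vertex_part_edge_coset[OF a(1,2)])
      ultimately show ?thesis by blast
    qed
    obtain a where a: "a \<in> carrier ?W'" "f (e ?v) = edge_coset H (g ?v, a)"
      using coset[OF vw(1)] by blast
    obtain b where b: "b \<in> carrier ?W'" "f (e ?w) = edge_coset H (g ?w, b)"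
      using coset[OF vw(2)] by blast
    have "edge_coset H (\<zero>\<^bsub>?V'\<^esub>, wedge (verts H) (g ?v) (g ?w)) = \<zero>\<^bsub>?L'\<^esub>"
      using zero edge_coset_bracket[OF module_hom_carrier[OF g vw(1)] a(1) module_hom_carrier[OF g vw(2)] b(1)]
      unfolding a(2) b(2) by simp
    then have "(\<zero>\<^bsub>?V'\<^esub>, wedge (verts H) (g ?v) (g ?w)) \<in> edge_ideal H"
      by (subst (asm) edge_coset_eq_zero_iff) (simp_all add: free_nilpotent_simps wedge_in_carrier)
    then have mem: "wedge (verts H) (g ?v) (g ?w) \<in> module.span ?K ?W'
        {wedge (verts H) (vertex_vector (verts H) i) (vertex_vector (verts H) j) | i j. i \<rightarrow>\<^bsub>H\<^esub> j}"
      by (simp add: edge_ideal_eq)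
    have "\<not> l \<rightarrow>\<^bsub>H\<^esub> k" using kl(3) H.graph_symmetric by blast
    then show ?thesis by (rule wedge_in_edge_span[OF mem kl])
  qed
  ultimately have "commuting_family (verts G) (\<lambda>i j. i \<rightarrow>\<^bsub>G\<^esub> j) (verts H) (\<lambda>i j. i \<rightarrow>\<^bsub>H\<^esub> j)
      (\<lambda>i. g (vertex_vector (verts G) i))"
    by (intro commuting_family.intro commuting_family_axioms.intro simple_graph_verts G H)
  then show ?thesis by blast
qed

subsection \<open>From graphs to Lie algebras\<close>

text \<open>Pullback along \<open>\<tau>\<close>, which reverses direction: a map from
  \<open>S\<close> to \<open>R\<close> acts from functions on \<open>R\<close> to functions on
  \<open>S\<close>.\<close>

definition reindex :: "'s set \<Rightarrow> ('s \<Rightarrow> 'r) \<Rightarrow> ('r \<Rightarrow> 'k) \<Rightarrow> 's \<Rightarrow> 'k" where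
  "reindex S \<tau> v = (\<lambda>j\<in>S. v (\<tau> j))"

lemma reindex_hom:
  assumes "\<tau> \<in> S \<rightarrow> R"
  shows "reindex S \<tau> \<in> module_hom (class_ring :: 'k::field ring) (vertex_space R) (vertex_space S)"
  using assms by (intro module_homI) (auto simp: reindex_def func_space_simps fun_eq_iff)

lemma reindex_bij:
  assumes "bij_betw \<tau> S R"
  shows "bij_betw (reindex S \<tau>) (carrier (vertex_space R :: ('k::field, _) module)) (carrier (vertex_space S))"
proof (rule bij_betw_byWitness[where f' = "reindex R (inv_into S \<tau>)"])
  note inv = bij_betw_inv_into_left[OF assms] bij_betw_inv_into_right[OF assms]
    bij_betwE[OF assms] bij_betwE[OF bij_betw_inv_into[OF assms]]
  show "\<forall>v\<in>carrier (vertex_space R). reindex R (inv_into S \<tau>) (reindex S \<tau> v) = v"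
    "\<forall>v\<in>carrier (vertex_space S). reindex S \<tau> (reindex R (inv_into S \<tau>) v) = v"
    using inv by (auto simp: reindex_def func_space_simps fun_eq_iff PiE_def extensional_def)
qed (auto simp: reindex_def func_space_simps)

lemma reindex_tensor:
  assumes "\<tau> \<in> S \<rightarrow> R"
  shows "reindex (S \<times> S) (map_prod \<tau> \<tau>) (tensor R v w) = tensor S (reindex S \<tau> v) (reindex S \<tau> w)"
  using assms by (auto simp: reindex_def tensor_def fun_eq_iff)

lemma reindex_vertex_vector:
  assumes "bij_betw \<tau> S R" and "i \<in> S"
  shows "reindex S \<tau> (vertex_vector R (\<tau> i)) = vertex_vector S i"
  using assms by (auto simp: reindex_def vertex_vector_def fun_eq_iff bij_betw_def inj_on_def)

text \<open>Pullback along \<open>\<tau>\<close> is compatible with tensors, hence with wedges and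
  the bracket of the free algebra, and carries one edge ideal onto the other, so it passes to the
  quotients.\<close>

lemma lie_isomorphic_of_bij:
  fixes G :: "('a, 'b) pre_digraph" and H :: "('c, 'd) pre_digraph"
  assumes wf: "wf_digraph G" "wf_digraph H" and bij: "bij_betw \<tau> (verts H) (verts G)"
    and adj: "\<And>i j. \<lbrakk>i \<in> verts H; j \<in> verts H\<rbrakk> \<Longrightarrow> \<tau> i \<rightarrow>\<^bsub>G\<^esub> \<tau> j \<longleftrightarrow> i \<rightarrow>\<^bsub>H\<^esub> j"
  shows "lie_isomorphic (class_ring :: 'k::field ring) (graph_lie_algebra G) (graph_lie_algebra H)"
proof -
  let ?K = "class_ring :: 'k ring" and ?T = "verts G" and ?S = "verts H"
  let ?V = "vertex_space ?T :: ('k, _) module" and ?V' = "vertex_space ?S :: ('k, _) module"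
  let ?W = "exterior_square ?T :: ('k, _) module" and ?W' = "exterior_square ?S :: ('k, _) module"
  let ?N = "free_nilpotent_lie_algebra ?T :: ('k, _) module"
  let ?N' = "free_nilpotent_lie_algebra ?S :: ('k, _) module"
  let ?L = "graph_lie_algebra G :: ('k, _) module" and ?L' = "graph_lie_algebra H :: ('k, _) module"
  define R :: "('a \<Rightarrow> 'k) \<Rightarrow> 'c \<Rightarrow> 'k" where "R = reindex ?S \<tau>"
  define R2 :: "('a \<times> 'a \<Rightarrow> 'k) \<Rightarrow> 'c \<times> 'c \<Rightarrow> 'k" where "R2 = reindex (?S \<times> ?S) (map_prod \<tau> \<tau>)"
  define F where "F = map_prod R ((`) R2)"
  have \<tau>: "\<tau> \<in> ?S \<rightarrow> ?T" using bij by (auto simp: bij_betw_def)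
  have R: "R \<in> module_hom ?K ?V ?V'" "bij_betw R (carrier ?V) (carrier ?V')"
    unfolding R_def by (rule reindex_hom[OF \<tau>], rule reindex_bij[OF bij])
  have bij2: "bij_betw (map_prod \<tau> \<tau>) (?S \<times> ?S) (?T \<times> ?T)"
    using bij by (auto simp: bij_betw_def map_prod_inj_on map_prod_surj_on)
  have R2: "R2 \<in> module_hom ?K (tensor_square ?T) (tensor_square ?S)"
    "bij_betw R2 (carrier (tensor_square ?T)) (carrier (tensor_square ?S))"
    unfolding R2_def using \<tau> by (auto intro!: reindex_hom reindex_bij[OF bij2])
  have R2_tensor: "R2 (tensor ?T v w) = tensor ?S (R v) (R w)" for v w
    unfolding R_def R2_def by (rule reindex_tensor[OF \<tau>])

  have "R2 ` square_tensors ?T = square_tensors ?S"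
  proof -
    have "R2 ` square_tensors ?T = module.span ?K (tensor_square ?S)
        (R2 ` {tensor ?T v v | v. v \<in> carrier ?V})"
      unfolding square_tensors_def
      by (rule image_span[OF module_func_space module_func_space R2(1)]) (auto simp: tensor_in_carrier)
    also have "R2 ` {tensor ?T v v | v. v \<in> carrier ?V} = {tensor ?S (R v) (R v) | v. v \<in> carrier ?V}"
      using R2_tensor by (auto simp: image_iff) metis
    also have "\<dots> = {tensor ?S v v | v. v \<in> carrier ?V'}"
      unfolding bij_betw_imp_surj_on[OF R(2), symmetric] by blast
    finally show ?thesis unfolding square_tensors_def .
  qed
  then have E: "(`) R2 \<in> module_hom ?K ?W ?W'" "bij_betw ((`) R2) (carrier ?W) (carrier ?W')"
    and E_wedge: "R2 ` wedge ?T v w = wedge ?S (R v) (R w)" for v w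
    using quotient_image_hom[OF module_func_space module_func_space R2(1) submodule_square_tensors]
      quotient_image_bij[OF module_func_space R2(1) submodule_square_tensors R2(2)]
      image_coset[OF R2(1) submodule.subset[OF submodule_square_tensors] tensor_in_carrier, of v w]
    by (simp_all add: exterior_square_def wedge_def R2_tensor)

  have F: "F \<in> module_hom ?K ?N ?N'"
    by (rule module_homI)
      (auto simp: F_def free_nilpotent_simps module_hom_add[OF R(1)] module_hom_smult[OF R(1)]
        module_hom_add[OF E(1)] module_hom_smult[OF E(1)] module_hom_carrier[OF R(1)]
        module_hom_carrier[OF E(1)])
  have F_bij: "bij_betw F (carrier ?N) (carrier ?N')"
    using R(2) E(2)
    by (auto simp: F_def bij_betw_def free_nilpotent_simps map_prod_inj_on map_prod_surj_on)
  have R_zero: "R \<zero>\<^bsub>?V\<^esub> = \<zero>\<^bsub>?V'\<^esub>"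
    by (rule module_hom_zero[OF module_func_space module_func_space R(1)])
  have F_bracket: "F (x \<otimes>\<^bsub>?N\<^esub> y) = F x \<otimes>\<^bsub>?N'\<^esub> F y" for x y
    by (cases x; cases y) (simp add: F_def free_nilpotent_simps R_zero E_wedge)

  have "(`) R2 ` {wedge ?T (vertex_vector ?T i) (vertex_vector ?T j) | i j. i \<rightarrow>\<^bsub>G\<^esub> j} =
      {wedge ?S (vertex_vector ?S i) (vertex_vector ?S j) | i j. i \<rightarrow>\<^bsub>H\<^esub> j}" (is "_ ` ?A = ?B")
  proof -
    have vv: "R (vertex_vector ?T (\<tau> i)) = vertex_vector ?S i" if "i \<in> ?S" for i
      unfolding R_def by (rule reindex_vertex_vector[OF bij that])
    \<comment> \<open>Parametrizes the edge wedges of both graphs by the adjacent pairs of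
      \<open>H\<close>.\<close>
    have "arcs_ends G = map_prod \<tau> \<tau> ` arcs_ends H"
    proof (intro equalityI subrelI)
      fix i j assume ij: "i \<rightarrow>\<^bsub>G\<^esub> j"
      then obtain i' j' where ij': "i' \<in> ?S" "j' \<in> ?S" "i = \<tau> i'" "j = \<tau> j'"
        using wf_digraph.adj_in_verts[OF wf(1) ij] bij_betw_imp_surj_on[OF bij] by (metis imageE)
      then have "i' \<rightarrow>\<^bsub>H\<^esub> j'" using ij adj by simp
      then show "(i, j) \<in> map_prod \<tau> \<tau> ` arcs_ends H" using ij' by force
    qed (use adj wf_digraph.adj_in_verts[OF wf(2)] in auto)
    then have "?A = (\<lambda>(i, j). wedge ?T (vertex_vector ?T (\<tau> i)) (vertex_vector ?T (\<tau> j))) ` arcs_ends H"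
      by force
    also have "(`) R2 ` \<dots> = (\<lambda>(i, j). wedge ?S (vertex_vector ?S i) (vertex_vector ?S j)) ` arcs_ends H"
    proof -
      have "R2 ` wedge ?T (vertex_vector ?T (\<tau> i)) (vertex_vector ?T (\<tau> j)) =
          wedge ?S (vertex_vector ?S i) (vertex_vector ?S j)" if "i \<rightarrow>\<^bsub>H\<^esub> j" for i j
        using wf_digraph.adj_in_verts[OF wf(2) that] by (simp add: E_wedge vv)
      then show ?thesis unfolding image_image by (intro image_cong) (auto del: equalityI)
    qed
    also have "\<dots> = ?B" by force
    finally show ?thesis .
  qed
  moreover have "?A \<subseteq> carrier ?W" using wedge_in_carrier by blast
  note image_span[OF module_exterior_square module_exterior_square E(1) this]
  ultimately have span: "(`) R2 ` module.span ?K ?W ?A = module.span ?K ?W' ?B" by simp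
  have F_ideal: "F ` edge_ideal G = edge_ideal H"
    unfolding edge_ideal_eq F_def span[symmetric] by (force simp: R_zero)

  have hom: "(`) F \<in> module_hom ?K ?L ?L'" "bij_betw ((`) F) (carrier ?L) (carrier ?L')"
    using quotient_image_hom[OF module_free_nilpotent module_free_nilpotent F submodule_edge_ideal]
      quotient_image_bij[OF module_free_nilpotent F submodule_edge_ideal F_bij] F_ideal
    by (simp_all add: graph_lie_algebra_def)
  have coset: "F ` edge_coset G z = edge_coset H (F z)" if "z \<in> carrier ?N" for z
    using image_coset[OF F submodule.subset[OF submodule_edge_ideal] that] F_ideal by simp
  interpret N: lie_algebra ?K ?N by (rule lie_algebra_free_nilpotent)
  have "F ` (X \<otimes>\<^bsub>?L\<^esub> Y) = F ` X \<otimes>\<^bsub>?L'\<^esub> F ` Y" if XY: "X \<in> carrier ?L" "Y \<in> carrier ?L" for X Y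
  proof -
    obtain x y where xy: "x \<in> carrier ?N" "y \<in> carrier ?N" "X = edge_coset G x" "Y = edge_coset G y"
      using XY unfolding graph_lie_algebra_def carrier_quotient by blast
    have "X \<otimes>\<^bsub>?L\<^esub> Y = edge_coset G (x \<otimes>\<^bsub>?N\<^esub> y)"
      unfolding graph_lie_algebra_def xy(3,4)
      by (rule lie_ideal.quotient_bracket[OF lie_ideal_edge_ideal xy(1,2)])
    moreover have "edge_coset H (F x) \<otimes>\<^bsub>?L'\<^esub> edge_coset H (F y) = edge_coset H (F x \<otimes>\<^bsub>?N'\<^esub> F y)"
      unfolding graph_lie_algebra_def
      by (intro lie_ideal.quotient_bracket[OF lie_ideal_edge_ideal] module_hom_carrier[OF F] xy(1,2))
    ultimately show ?thesis
      by (simp only: xy(3,4) coset[OF xy(1)] coset[OF xy(2)] coset[OF N.bracket_closed[OF xy(1,2)]] F_bracket)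
  qed
  with hom show ?thesis unfolding lie_isomorphic_def by blast
qed

section \<open>Graph isomorphisms as bijections of the vertices\<close>

text \<open>Without parallel arcs an arc is determined by its ends, so a bijection of the vertices
  that preserves and reflects adjacency extends to the arcs.\<close>

lemma digraph_iso_iff_bij:
  fixes G :: "('a, 'b) pre_digraph" and H :: "('c, 'd) pre_digraph"
  assumes G: "nomulti_digraph G" and H: "nomulti_digraph H"
  shows "digraph_iso G H \<longleftrightarrow> (\<exists>\<sigma>. bij_betw \<sigma> (verts G) (verts H) \<and>
    (\<forall>i\<in>verts G. \<forall>j\<in>verts G. \<sigma> i \<rightarrow>\<^bsub>H\<^esub> \<sigma> j \<longleftrightarrow> i \<rightarrow>\<^bsub>G\<^esub> j))" (is "_ \<longleftrightarrow> (\<exists>\<sigma>. ?iso \<sigma>)")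
proof
  interpret G: nomulti_digraph G by (rule G)
  interpret H: nomulti_digraph H by (rule H)
  show "\<exists>\<sigma>. ?iso \<sigma>" if "digraph_iso G H"
  proof -
    from that obtain \<psi> where \<psi>: "G.digraph_isomorphism \<psi>" and H_eq: "H = app_iso \<psi> G"
      unfolding digraph_iso_def by blast
    have bij: "bij_betw (iso_verts \<psi>) (verts G) (verts H)"
      using \<psi> by (simp add: H_eq bij_betw_def G.digraph_isomorphism_def)
    have "iso_verts \<psi> i \<rightarrow>\<^bsub>H\<^esub> iso_verts \<psi> j \<longleftrightarrow> i \<rightarrow>\<^bsub>G\<^esub> j" if ij: "i \<in> verts G" "j \<in> verts G" for i j
    proof -
      have "iso_verts \<psi> i \<rightarrow>\<^bsub>H\<^esub> iso_verts \<psi> j \<longleftrightarrow>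
          (\<exists>a\<in>arcs G. iso_verts \<psi> (tail G a) = iso_verts \<psi> i \<and> iso_verts \<psi> (head G a) = iso_verts \<psi> j)"
        using \<psi> by (force simp: H_eq arcs_ends_conv G.digraph_isomorphism_def)
      also have "\<dots> \<longleftrightarrow> i \<rightarrow>\<^bsub>G\<^esub> j"
        using ij \<psi> by (force simp: arcs_ends_conv)
      finally show ?thesis .
    qed
    with bij show ?thesis by blast
  qed
  show "digraph_iso G H" if "\<exists>\<sigma>. ?iso \<sigma>"
  proof -
    from that obtain \<sigma> where bij: "bij_betw \<sigma> (verts G) (verts H)"
      and adj: "\<And>i j. \<lbrakk>i \<in> verts G; j \<in> verts G\<rbrakk> \<Longrightarrow> \<sigma> i \<rightarrow>\<^bsub>H\<^esub> \<sigma> j \<longleftrightarrow> i \<rightarrow>\<^bsub>G\<^esub> j" by blast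
    have "\<exists>b\<in>arcs H. tail H b = \<sigma> (tail G a) \<and> head H b = \<sigma> (head G a)" if a: "a \<in> arcs G" for a
    proof -
      have "tail G a \<rightarrow>\<^bsub>G\<^esub> head G a" using a by (auto simp: arcs_ends_conv)
      then have "\<sigma> (tail G a) \<rightarrow>\<^bsub>H\<^esub> \<sigma> (head G a)" using adj a by simp
      then show ?thesis by (auto simp: arcs_ends_conv)
    qed
    then obtain \<beta> where \<beta>: "\<And>a. a \<in> arcs G \<Longrightarrow>
        \<beta> a \<in> arcs H \<and> tail H (\<beta> a) = \<sigma> (tail G a) \<and> head H (\<beta> a) = \<sigma> (head G a)"
      by metis
    have inj: "inj_on \<sigma> (verts G)" using bij by (simp add: bij_betw_def)
    have "inj_on \<beta> (arcs G)"
    proof (rule inj_onI)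
      fix a b assume ab: "a \<in> arcs G" "b \<in> arcs G" "\<beta> a = \<beta> b"
      then have "tail G a = tail G b" "head G a = head G b"
        using \<beta>[OF ab(1)] \<beta>[OF ab(2)] inj by (auto simp: inj_on_eq_iff)
      then show "a = b" using ab by (intro G.no_multi_arcs) (auto simp: arc_to_ends_def)
    qed
    moreover have "arcs H \<subseteq> \<beta> ` arcs G"
    proof
      fix b assume b: "b \<in> arcs H"
      obtain i j where ij: "i \<in> verts G" "j \<in> verts G" "tail H b = \<sigma> i" "head H b = \<sigma> j"
        using b bij_betw_imp_surj_on[OF bij] H.wellformed by (metis imageE)
      have "\<sigma> i \<rightarrow>\<^bsub>H\<^esub> \<sigma> j" using b ij by (force simp: arcs_ends_conv)
      then have "i \<rightarrow>\<^bsub>G\<^esub> j" using adj ij by simp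
      then obtain a where a: "a \<in> arcs G" "tail G a = i" "head G a = j" by (auto simp: arcs_ends_conv)
      have "b = \<beta> a" using b \<beta>[OF a(1)] a ij by (intro H.no_multi_arcs) (auto simp: arc_to_ends_def)
      then show "b \<in> \<beta> ` arcs G" using a by blast
    qed
    \<comment> \<open>The record takes the head and tail functions of \<open>H\<close>, because
      \<open>app_iso\<close> must give \<open>H\<close> itself.\<close>
    ultimately have "G.digraph_isomorphism \<lparr>iso_verts = \<sigma>, iso_arcs = \<beta>, iso_head = head H, iso_tail = tail H\<rparr>
        \<and> H = app_iso \<lparr>iso_verts = \<sigma>, iso_arcs = \<beta>, iso_head = head H, iso_tail = tail H\<rparr> G"
      using \<beta> inj bij_betw_imp_surj_on[OF bij] G.wf_digraph
      by (auto simp: G.digraph_isomorphism_def app_iso_def intro!: pre_digraph.equality)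
    then show ?thesis unfolding digraph_iso_def by blast
  qed
qed

theorem theorem1:
  fixes G :: "('a, 'b) pre_digraph" and H :: "('c, 'd) pre_digraph"
  assumes "graph G" and "graph H"
  shows "lie_isomorphic (class_ring :: 'k::field ring) (graph_lie_algebra G) (graph_lie_algebra H)
    \<longleftrightarrow> digraph_iso G H"
proof -
  let ?K = "class_ring :: 'k ring"
  let ?L = "graph_lie_algebra G :: ('k, _) module" and ?L' = "graph_lie_algebra H :: ('k, _) module"
  interpret G: graph G by (rule assms)
  interpret H: graph H by (rule assms)
  interpret L: lie_algebra ?K ?L by (rule lie_algebra_graph)
  note iso_iff = digraph_iso_iff_bij[OF G.nomulti_digraph H.nomulti_digraph]
  show ?thesis
  proof
    assume "lie_isomorphic ?K ?L ?L'"
    then obtain f where f: "f \<in> module_hom ?K ?L ?L'" and bij: "bij_betw f (carrier ?L) (carrier ?L')"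
      and f_bracket: "\<And>X Y. \<lbrakk>X \<in> carrier ?L; Y \<in> carrier ?L\<rbrakk> \<Longrightarrow> f (X \<otimes>\<^bsub>?L\<^esub> Y) = f X \<otimes>\<^bsub>?L'\<^esub> f Y"
      unfolding lie_isomorphic_def by blast
    let ?h = "inv_into (carrier ?L) f"
    have h: "?h \<in> module_hom ?K ?L' ?L"
      by (rule module_hom_inv_into[OF module_graph_lie_algebra f bij])
    have hf: "?h (f X) = X" if "X \<in> carrier ?L" for X using bij_betw_inv_into_left[OF bij that] .
    have fh: "f (?h X) = X" if "X \<in> carrier ?L'" for X using bij_betw_inv_into_right[OF bij that] .
    have h_bracket: "?h (X \<otimes>\<^bsub>?L'\<^esub> Y) = ?h X \<otimes>\<^bsub>?L\<^esub> ?h Y" if XY: "X \<in> carrier ?L'" "Y \<in> carrier ?L'" for X Y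
    proof -
      note XY' = module_hom_carrier[OF h XY(1)] module_hom_carrier[OF h XY(2)]
      have "f (?h X \<otimes>\<^bsub>?L\<^esub> ?h Y) = X \<otimes>\<^bsub>?L'\<^esub> Y" using f_bracket[OF XY'] fh XY by simp
      then show ?thesis using hf[OF L.bracket_closed[OF XY']] by simp
    qed
    obtain x :: "'a \<Rightarrow> 'c \<Rightarrow> 'k" where
      "commuting_family (verts G) (\<lambda>i j. i \<rightarrow>\<^bsub>G\<^esub> j) (verts H) (\<lambda>i j. i \<rightarrow>\<^bsub>H\<^esub> j) x"
      using commuting_family_of_lie_hom[OF assms f f_bracket h h_bracket hf] by blast
    then interpret x: commuting_family "verts G" "\<lambda>i j. i \<rightarrow>\<^bsub>G\<^esub> j" "verts H" "\<lambda>i j. i \<rightarrow>\<^bsub>H\<^esub> j" x .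
    obtain y :: "'c \<Rightarrow> 'a \<Rightarrow> 'k" where
      "commuting_family (verts H) (\<lambda>i j. i \<rightarrow>\<^bsub>H\<^esub> j) (verts G) (\<lambda>i j. i \<rightarrow>\<^bsub>G\<^esub> j) y"
      using commuting_family_of_lie_hom[OF assms(2,1) h h_bracket f f_bracket fh] by blast
    then interpret y: commuting_family "verts H" "\<lambda>i j. i \<rightarrow>\<^bsub>H\<^esub> j" "verts G" "\<lambda>i j. i \<rightarrow>\<^bsub>G\<^esub> j" y .
    \<comment> \<open>The family \<open>y\<close> of the inverse isomorphism supplies the reverse
      bounds on the number of vertices and on the sum of the star sizes.\<close>
    show "digraph_iso G H"
      unfolding iso_iff by (rule x.graph_isomorphism[OF y.card_vertices_le y.sum_card_star_le])
  next
    assume "digraph_iso G H"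
    then obtain \<sigma> where bij: "bij_betw \<sigma> (verts G) (verts H)"
      and adj: "\<And>i j. \<lbrakk>i \<in> verts G; j \<in> verts G\<rbrakk> \<Longrightarrow> \<sigma> i \<rightarrow>\<^bsub>H\<^esub> \<sigma> j \<longleftrightarrow> i \<rightarrow>\<^bsub>G\<^esub> j"
      unfolding iso_iff by blast
    note inv = bij_betw_inv_into[OF bij]
    show "lie_isomorphic ?K ?L ?L'"
    \<comment> \<open>The map from the algebra of \<open>G\<close> to that of \<open>H\<close> is a
      pullback, hence the inverse of \<open>\<sigma>\<close>.\<close>
    proof (rule lie_isomorphic_of_bij[OF G.wf_digraph H.wf_digraph inv])
      fix i j assume "i \<in> verts H" "j \<in> verts H"
      then show "inv_into (verts G) \<sigma> i \<rightarrow>\<^bsub>G\<^esub> inv_into (verts G) \<sigma> j \<longleftrightarrow> i \<rightarrow>\<^bsub>H\<^esub> j"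
        using adj bij_betwE[OF inv] bij_betw_inv_into_right[OF bij] by metis
    qed
  qed
qed

end
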